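(* Fix an integer $d\ge3$ and fix an integer $\theta$ sufficiently large depending on $d$. Then for all $n$ sufficiently large, $$n^{-1-\frac{2}{\theta}-\frac{4d^2+3}{\theta^{3/2}}}\le p_{\mathrm c}(2,d)\le n^{-1-\frac{2}{\theta}-\frac{\sqrt{8(d-2.1)}}{\theta^{3/2}}}.$$
   Context: Hamming torus: $V=[n]^d$ with $[n]=\{1,\dots,n\}$; two vertices $v,w$ are adjacent ($v\sim w$) iff $v-w$ has exactly one nonzero coordinate. Bootstrap percolation with threshold $\theta$: starting from $\omega_0\in\{0,1\}^V$, set $\omega_{j+1}(v)=1$ if $\omega_j(v)=1$ or $\sum_{w\sim v}\omega_j(w)\ge\theta$, and $\omega_{j+1}(v)=0$ otherwise; $\omega_\infty$ is the pointwise limit of the increasing sequence $\omega_j$. Under $\mathbb{P}_p$ the values $\omega_0(v)$, $v\in V$, are i.i.d. Bernoulli($p$). A $2$-dimensional subgraph is a set of vertices obtained by fixing $d-2$ coordinates and letting the other two range over $[n]$. $p_{\mathrm c}(2,d)$ (depending on $n,\theta$) is the value of $p$ for which $\mathbb{P}_p(\exists\text{ a }2\text{-dimensional subgraph }F\text{ with }\omega_\infty|_F\equiv 1)=1/2$. *)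

theory Defs
  imports "HOL-Probability.Probability"
begin

(* The d coordinates are indexed by {..<d}; a vertex is undefined outside {..<d}. *)

type_synonym vertex = "nat \<Rightarrow> nat"

definition torus :: "nat \<Rightarrow> nat \<Rightarrow> vertex set" where
  "torus n d = {..<d} \<rightarrow>\<^sub>E {1..n}"

definition adjacent :: "nat \<Rightarrow> vertex \<Rightarrow> vertex \<Rightarrow> bool" where
  "adjacent d v w \<longleftrightarrow> card {i \<in> {..<d}. v i \<noteq> w i} = 1"

(* A configuration in {0,1}^V is a predicate on vertices that is False outside V. *)

definition bp_step :: "nat \<Rightarrow> nat \<Rightarrow> nat \<Rightarrow> (vertex \<Rightarrow> bool) \<Rightarrow> (vertex \<Rightarrow> bool)" where
  "bp_step n d \<theta> \<omega> = (\<lambda>v. \<omega> v \<or>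
     (v \<in> torus n d \<and> (\<Sum>w | w \<in> torus n d \<and> adjacent d v w. of_bool (\<omega> w)) \<ge> \<theta>))"

definition bp_config :: "nat \<Rightarrow> nat \<Rightarrow> nat \<Rightarrow> (vertex \<Rightarrow> bool) \<Rightarrow> nat \<Rightarrow> (vertex \<Rightarrow> bool)" where
  "bp_config n d \<theta> \<omega>\<^sub>0 j = (bp_step n d \<theta> ^^ j) \<omega>\<^sub>0"

(* The limit is taken in the (discrete) topology of type bool. *)

definition bp_limit :: "nat \<Rightarrow> nat \<Rightarrow> nat \<Rightarrow> (vertex \<Rightarrow> bool) \<Rightarrow> (vertex \<Rightarrow> bool)" where
  "bp_limit n d \<theta> \<omega>\<^sub>0 = (\<lambda>v. lim (\<lambda>j. bp_config n d \<theta> \<omega>\<^sub>0 j v))"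

definition two_dim_subgraph :: "nat \<Rightarrow> nat \<Rightarrow> vertex set \<Rightarrow> bool" where
  "two_dim_subgraph n d F \<longleftrightarrow>
     (\<exists>I u. I \<subseteq> {..<d} \<and> card I = 2 \<and> u \<in> torus n d \<and>
        F = {v \<in> torus n d. \<forall>i \<in> {..<d} - I. v i = u i})"

definition initial_pmf :: "nat \<Rightarrow> nat \<Rightarrow> real \<Rightarrow> (vertex \<Rightarrow> bool) pmf" where
  "initial_pmf n d p = Pi_pmf (torus n d) False (\<lambda>_. bernoulli_pmf p)"

definition prob_plane_filled :: "nat \<Rightarrow> nat \<Rightarrow> nat \<Rightarrow> real \<Rightarrow> real" where
  "prob_plane_filled n d \<theta> p =
     measure_pmf.prob (initial_pmf n d p)
       {\<omega>\<^sub>0. \<exists>F. two_dim_subgraph n d F \<and> (\<forall>v \<in> F. bp_limit n d \<theta> \<omega>\<^sub>0 v)}"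

(* For d >= 2, n >= 1 and theta >= 1 the probability is strictly increasing and continuous in p
   on [0,1], with value 0 at p = 0 and 1 at p = 1, so such a p exists and is unique.
   The restriction to [0,1] is needed because bernoulli_pmf clamps its argument. *)

definition p_crit2 :: "nat \<Rightarrow> nat \<Rightarrow> nat \<Rightarrow> real" where
  "p_crit2 n d \<theta> = (THE p. 0 \<le> p \<and> p \<le> 1 \<and> prob_plane_filled n d \<theta> p = 1 / 2)"

lemma bp_config_mono: "j \<le> k \<Longrightarrow> bp_config n d \<theta> \<omega>\<^sub>0 j v \<Longrightarrow> bp_config n d \<theta> \<omega>\<^sub>0 k v"
  by (induction k rule: dec_induct) (auto simp: bp_config_def bp_step_def)

lemma bp_config_tendsto:
  "(\<lambda>j. bp_config n d \<theta> \<omega>\<^sub>0 j v) \<longlonglongrightarrow> (\<exists>j. bp_config n d \<theta> \<omega>\<^sub>0 j v)"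
proof (cases "\<exists>j. bp_config n d \<theta> \<omega>\<^sub>0 j v")
  case True
  then obtain k where "bp_config n d \<theta> \<omega>\<^sub>0 k v" by blast
  then have "\<forall>\<^sub>F j in sequentially. bp_config n d \<theta> \<omega>\<^sub>0 j v = True"
    unfolding eventually_sequentially using bp_config_mono by blast
  with True show ?thesis by (simp add: tendsto_eventually)
qed simp

lemma bp_limit_iff: "bp_limit n d \<theta> \<omega>\<^sub>0 v \<longleftrightarrow> (\<exists>j. bp_config n d \<theta> \<omega>\<^sub>0 j v)"
  unfolding bp_limit_def using limI[OF bp_config_tendsto] by simp

end

theory Submission
  imports Defs "HOL-Real_Asymp.Real_Asymp"
begin

text \<open>
  Write \<open>p = n powr (- 1 - \<alpha>)\<close> with \<open>\<alpha> = 2 / \<theta> + c / \<theta> powr (3 / 2)\<close>.  Then \<open>n * p = n powr (- \<alpha>)\<close>, so a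
  given line contains \<open>k\<close> open vertices with probability about \<open>n powr (- k * \<alpha>)\<close>, and a family of
  \<open>n\<close> parallel lines contains such a line with probability about \<open>n powr (1 - k * \<alpha>)\<close> (or close to
  one, if this exponent is positive).  The sign changes near \<open>k = \<theta> / 2 - c * sqrt \<theta> / 4\<close>.

  Upper bound.  Suppose that a plane has rows \<open>R 0, \<dots>, R (\<theta> - 1)\<close> and columns \<open>C 0, \<dots>, C (\<theta> - 1)\<close>,
  where \<open>R i\<close> and \<open>C i\<close> contain at least \<open>\<theta> / 2 - i\<close> open vertices off the intersections.  The intersection
  of \<open>R i\<close> and \<open>C j\<close> sees \<open>(\<theta> / 2 - i) + (\<theta> / 2 - j)\<close> open vertices and the earlier intersections,
  \<open>j\<close> on its row and \<open>i\<close> on its column, hence is infected by induction on \<open>i + j\<close>.  Then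
  the chosen rows are full, and therefore every column is (lemma \<open>grid_fills\<close>).  Only the first
  \<open>c * sqrt \<theta> / 4\<close> rows and columns are atypical; the product of their probabilities is
  \<open>n powr (- (c\<^sup>2 / 8 + o 1))\<close> as \<open>\<theta>\<close> grows.  The \<open>n ^ (d - 2)\<close> parallel planes are independent, so
  one of them fills as soon as \<open>c\<^sup>2 < 8 * (d - 2)\<close> (lemma \<open>supercritical\<close>).

  Lower bound.  Call a point \<open>w\<close> of a line hot if at least \<open>T\<close> open vertices lie on the other
  lines through \<open>w\<close>.  Let \<open>2 * T + d * m \<le> \<theta>\<close>.  As long as no line has \<open>m\<close> hot points, every
  infected vertex is open, or lies on a line with more than \<open>T\<close> open vertices, or has at least
  \<open>\<theta> - d * m\<close> open neighbours: a first exception would have more than \<open>d * m\<close> infected neighbours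
  that are not open, all of them hot for the line that joins them to the exception, and so
  \<open>m\<close> of them would be on one line (lemma \<open>infected_imp_explained\<close>).  A filled plane is
  incompatible with this description (lemma \<open>plane_filled_imp_hot_lines\<close>).  Hotness of the
  different points of a line is independent, because it is decided in disjoint slices of the torus.
  Hence the expected number of lines with \<open>m\<close> hot points has order at most
  \<open>n powr (d + m * (1 - T * \<alpha>))\<close>.  With \<open>m\<close> close to \<open>sqrt \<theta>\<close> and \<open>T\<close> close to \<open>(\<theta> - d * m) / 2\<close> the
  exponent tends to \<open>2 * d - c / 2\<close>, which is negative for \<open>c > 4 * d\<close> (lemma \<open>subcritical\<close>), in
  particular for \<open>c = 4 * d\<^sup>2 + 3\<close>.

  These estimates locate the critical probability because the probability of filling a plane is
  continuous and strictly increasing in \<open>p\<close>.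
\<close>

section \<open>Independence in product measures\<close>

definition depends_on :: "('a \<Rightarrow> 'b) set \<Rightarrow> 'a set \<Rightarrow> bool" where
  "depends_on E B \<longleftrightarrow> (\<forall>f g. (\<forall>x\<in>B. f x = g x) \<longrightarrow> (f \<in> E \<longleftrightarrow> g \<in> E))"

lemma depends_onD: "depends_on E B \<Longrightarrow> (\<And>x. x \<in> B \<Longrightarrow> f x = g x) \<Longrightarrow> f \<in> E \<longleftrightarrow> g \<in> E"
  by (auto simp: depends_on_def)

lemma depends_on_mono: "depends_on E B \<Longrightarrow> B \<subseteq> C \<Longrightarrow> depends_on E C"
  unfolding depends_on_def by blast

lemma depends_on_Compl: "depends_on E B \<Longrightarrow> depends_on (- E) B"
  unfolding depends_on_def by blast

lemma depends_on_UN: "(\<And>j. j \<in> J \<Longrightarrow> depends_on (E j) (B j)) \<Longrightarrow> depends_on (\<Union>j\<in>J. E j) (\<Union>j\<in>J. B j)"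
proof -
  assume dep: "\<And>j. j \<in> J \<Longrightarrow> depends_on (E j) (B j)"
  have "f \<in> E j \<longleftrightarrow> g \<in> E j" if "j \<in> J" "\<forall>x\<in>\<Union>j\<in>J. B j. f x = g x" for f g j
    using dep[OF that(1)] by (rule depends_onD) (use that in auto)
  then show ?thesis unfolding depends_on_def by blast
qed

lemma depends_on_INT: "(\<And>j. j \<in> J \<Longrightarrow> depends_on (E j) (B j)) \<Longrightarrow> depends_on (\<Inter>j\<in>J. E j) (\<Union>j\<in>J. B j)"
proof -
  assume dep: "\<And>j. j \<in> J \<Longrightarrow> depends_on (E j) (B j)"
  have "f \<in> E j \<longleftrightarrow> g \<in> E j" if "j \<in> J" "\<forall>x\<in>\<Union>j\<in>J. B j. f x = g x" for f g j
    using dep[OF that(1)] by (rule depends_onD) (use that in auto)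
  then show ?thesis unfolding depends_on_def by blast
qed

text \<open>
  The supports of the two distributions are countable, so the rectangle may be cut down to a
  countable one.
\<close>

lemma prob_pair_pmf_Times:
  "measure_pmf.prob (pair_pmf M N) (A \<times> B) = measure_pmf.prob M A * measure_pmf.prob N B"
proof -
  have "measure_pmf.prob (pair_pmf M N) (A \<times> B)
      = measure_pmf.prob (pair_pmf M N) ((A \<inter> set_pmf M) \<times> (B \<inter> set_pmf N))"
    by (rule measure_prob_cong_0) (auto simp: set_pmf_iff pmf_pair)
  also have "\<dots> = measure_pmf.prob M (A \<inter> set_pmf M) * measure_pmf.prob N (B \<inter> set_pmf N)"
    by (rule measure_pmf_prob_product) auto
  finally show ?thesis by (simp add: measure_Int_set_pmf)
qed

text \<open>
  The product distribution over \<open>V\<close> is the image of the product of those over \<open>B\<close> and over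
  \<open>V - B\<close>; pulled back to this pair, the intersection becomes a rectangle.
\<close>

lemma prob_Int_independent:
  fixes P :: "'a \<Rightarrow> 'b pmf"
  assumes fin: "finite V" and "B \<subseteq> V" and E: "depends_on E B" and F: "depends_on F (V - B)"
  shows "measure_pmf.prob (Pi_pmf V dflt P) (E \<inter> F)
       = measure_pmf.prob (Pi_pmf V dflt P) E * measure_pmf.prob (Pi_pmf V dflt P) F"
proof -
  define h where "h = (\<lambda>(f, g) x. if x \<in> B then (f x :: 'b) else g x)"
  have *: "Pi_pmf V dflt P = map_pmf h (pair_pmf (Pi_pmf B dflt P) (Pi_pmf (V - B) dflt P))"
    unfolding h_def using Pi_pmf_union[of B "V - B" dflt P] assms
    by (auto simp: Un_absorb1 finite_subset)
  have hE: "h (f, g) \<in> E \<longleftrightarrow> f \<in> E" for f g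
    by (rule depends_onD[OF E]) (auto simp: h_def)
  have hF: "h (f, g) \<in> F \<longleftrightarrow> g \<in> F" for f g
    by (rule depends_onD[OF F]) (auto simp: h_def)
  have "h -` (E \<inter> F) = E \<times> F" "h -` E = E \<times> UNIV" "h -` F = UNIV \<times> F"
    using hE hF by auto
  then show ?thesis
    unfolding * by (simp add: measure_map_pmf prob_pair_pmf_Times)
qed

lemma prob_INT_independent:
  fixes P :: "'a \<Rightarrow> 'b pmf"
  assumes fin: "finite V" and "finite J" "disjoint_family_on B J"
    and "\<And>j. j \<in> J \<Longrightarrow> B j \<subseteq> V" and dep: "\<And>j. j \<in> J \<Longrightarrow> depends_on (E j) (B j)"
  shows "measure_pmf.prob (Pi_pmf V dflt P) (\<Inter>j\<in>J. E j)
       = (\<Prod>j\<in>J. measure_pmf.prob (Pi_pmf V dflt P) (E j))"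
  using assms(2-)
proof (induction J rule: finite_induct)
  case empty
  then show ?case by simp
next
  case (insert j J)
  have disj: "B j \<inter> (\<Union>i\<in>J. B i) = {}"
  proof -
    have "B j \<inter> B i = {}" if "i \<in> J" for i
      using that insert.hyps(2) by (intro disjoint_family_onD[OF insert.prems(1)]) auto
    then show ?thesis by blast
  qed
  have "depends_on (\<Inter>i\<in>J. E i) (\<Union>i\<in>J. B i)"
    using insert.prems by (intro depends_on_INT) auto
  then have "depends_on (\<Inter>i\<in>J. E i) (V - B j)"
    by (rule depends_on_mono) (use insert.prems(2) disj in auto)
  then have "measure_pmf.prob (Pi_pmf V dflt P) (E j \<inter> (\<Inter>i\<in>J. E i))
     = measure_pmf.prob (Pi_pmf V dflt P) (E j) * measure_pmf.prob (Pi_pmf V dflt P) (\<Inter>i\<in>J. E i)"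
    by (intro prob_Int_independent[OF fin insert.prems(2) insert.prems(3)]) simp_all
  moreover have "disjoint_family_on B J"
    using insert.prems(1) by (auto simp: disjoint_family_on_def)
  ultimately have "measure_pmf.prob (Pi_pmf V dflt P) (E j \<inter> (\<Inter>i\<in>J. E i))
     = measure_pmf.prob (Pi_pmf V dflt P) (E j) * (\<Prod>i\<in>J. measure_pmf.prob (Pi_pmf V dflt P) (E i))"
    using insert.IH insert.prems(2,3) by simp
  then show ?case
    by (simp add: prod.insert[OF insert.hyps])
qed

text \<open>
  This follows from \<open>(1 - q) ^ N \<le> exp (- N * q) \<le> 1 / (1 + N * q)\<close>.
\<close>

lemma one_minus_power_ge:
  fixes q :: real
  assumes "0 \<le> q" "q \<le> 1"
  shows "min 1 (real N * q) / 2 \<le> 1 - (1 - q) ^ N"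
proof -
  define y where "y = real N * q"
  have y: "0 \<le> y" using assms by (simp add: y_def)
  have "(1 - q) ^ N \<le> exp (- q) ^ N"
    using assms exp_ge_add_one_self[of "- q"] by (intro power_mono) auto
  also have "\<dots> = 1 / exp y"
    by (simp add: y_def exp_minus field_simps flip: exp_of_nat_mult)
  also have "\<dots> \<le> 1 / (1 + y)"
    using y exp_ge_add_one_self[of y] by (intro divide_left_mono) (auto intro: mult_pos_pos)
  finally have "1 - 1 / (1 + y) \<le> 1 - (1 - q) ^ N" by simp
  moreover have "min 1 y / 2 \<le> 1 - 1 / (1 + y)"
  proof (cases "y \<le> 1")
    case True
    then have "y * (1 + y) \<le> y * 2" using y by (intro mult_left_mono) auto
    then show ?thesis using y True by (simp add: field_simps)
  next
    case False
    then show ?thesis by (simp add: field_simps)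
  qed
  ultimately show ?thesis by (simp add: y_def)
qed

text \<open>
  For independent events the union bound is sharp up to the factor \<open>1 / 2\<close>, as long as it does not
  exceed one.
\<close>

lemma prob_UN_independent_ge:
  fixes P :: "'a \<Rightarrow> 'b pmf"
  assumes "finite V" "finite J" "disjoint_family_on B J"
    and "\<And>j. j \<in> J \<Longrightarrow> B j \<subseteq> V" and dep: "\<And>j. j \<in> J \<Longrightarrow> depends_on (E j) (B j)"
    and "0 \<le> q" and q: "\<And>j. j \<in> J \<Longrightarrow> q \<le> measure_pmf.prob (Pi_pmf V dflt P) (E j)"
  shows "min 1 (real (card J) * q) / 2 \<le> measure_pmf.prob (Pi_pmf V dflt P) (\<Union>j\<in>J. E j)"
proof (cases "J = {}")
  case False
  let ?M = "measure_pmf (Pi_pmf V dflt P)"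
  have compl: "measure ?M (- X) = 1 - measure ?M X" for X
    using measure_pmf.prob_compl[of X "Pi_pmf V dflt P"] by (simp add: Compl_eq_Diff_UNIV)
  have "q \<le> 1" using False q by (meson all_not_in_conv measure_pmf.prob_le_1 order_trans)
  then have "min 1 (real (card J) * q) / 2 \<le> 1 - (1 - q) ^ card J"
    using \<open>0 \<le> q\<close> by (rule one_minus_power_ge[rotated])
  also have "\<dots> \<le> 1 - (\<Prod>j\<in>J. measure ?M (- E j))"
  proof -
    have "(\<Prod>j\<in>J. measure ?M (- E j)) \<le> (\<Prod>j\<in>J. 1 - q)"
      using q by (intro prod_mono) (auto simp: compl)
    then show ?thesis by simp
  qed
  also have "(\<Prod>j\<in>J. measure ?M (- E j)) = measure ?M (\<Inter>j\<in>J. - E j)"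
    using assms by (intro prob_INT_independent[symmetric, where B = B]) (auto intro: depends_on_Compl)
  also have "1 - measure ?M (\<Inter>j\<in>J. - E j) = measure ?M (- (\<Inter>j\<in>J. - E j))"
    by (rule compl[symmetric])
  also have "- (\<Inter>j\<in>J. - E j) = (\<Union>j\<in>J. E j)" by auto
  finally show ?thesis .
qed simp

section \<open>Bernoulli percolation on a finite set\<close>

abbreviation "percolation V p \<equiv> Pi_pmf V False (\<lambda>_. bernoulli_pmf p)"

lemma prob_all_open:
  assumes "finite V" "B \<subseteq> V" "0 \<le> p" "p \<le> 1"
  shows "measure_pmf.prob (percolation V p) {\<omega>. \<forall>x\<in>B. \<omega> x} = p ^ card B"
proof -
  have "{\<omega>. \<forall>x\<in>B. \<omega> x} = Pi V (\<lambda>x. if x \<in> B then {True} else UNIV)"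
    using assms(2) by (auto simp: Pi_def)
  then have "measure_pmf.prob (percolation V p) {\<omega>. \<forall>x\<in>B. \<omega> x}
     = (\<Prod>x\<in>V. measure_pmf.prob (bernoulli_pmf p) (if x \<in> B then {True} else UNIV))"
    using assms by (simp add: measure_Pi_pmf_Pi)
  also have "\<dots> = (\<Prod>x\<in>V. if x \<in> B then p else 1)"
    using assms by (intro prod.cong) (auto simp: measure_pmf_single)
  also have "\<dots> = p ^ card B"
    using assms by (simp add: prod.If_cases Int_absorb1)
  finally show ?thesis .
qed

text \<open>
  Union bound over the sets of \<open>T\<close> vertices that might be open.
\<close>

lemma prob_many_open_le:
  assumes "finite V" "N \<subseteq> V" "0 \<le> p" "p \<le> 1"
  shows "measure_pmf.prob (percolation V p) {\<omega>. T \<le> card {x \<in> N. \<omega> x}} \<le> (real (card N) * p) ^ T"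
proof (cases "T \<le> card N")
  case False
  have finN: "finite N" using assms finite_subset by blast
  have "card {x \<in> N. \<omega> x} \<le> card N" for \<omega> using finN by (intro card_mono) auto
  then have "{\<omega>. T \<le> card {x \<in> N. \<omega> x}} = {}" using False by (auto dest: order_trans)
  then show ?thesis using assms by simp
next
  case True
  have finN: "finite N" using assms finite_subset by blast
  let ?S = "{A. A \<subseteq> N \<and> card A = T}"
  have finS: "finite ?S" using finN by simp
  have "{\<omega>. T \<le> card {x \<in> N. \<omega> x}} \<subseteq> (\<Union>A\<in>?S. {\<omega>. \<forall>x\<in>A. \<omega> x})"
  proof
    fix \<omega> assume "\<omega> \<in> {\<omega>. T \<le> card {x \<in> N. \<omega> x}}"
    then obtain A where "A \<subseteq> {x \<in> N. \<omega> x}" "card A = T"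
      using obtain_subset_with_card_n[of T "{x \<in> N. \<omega> x}"] by auto
    then show "\<omega> \<in> (\<Union>A\<in>?S. {\<omega>. \<forall>x\<in>A. \<omega> x})" by blast
  qed
  then have "measure_pmf.prob (percolation V p) {\<omega>. T \<le> card {x \<in> N. \<omega> x}}
     \<le> measure_pmf.prob (percolation V p) (\<Union>A\<in>?S. {\<omega>. \<forall>x\<in>A. \<omega> x})"
    by (intro measure_pmf.finite_measure_mono) auto
  also have "\<dots> \<le> (\<Sum>A\<in>?S. measure_pmf.prob (percolation V p) {\<omega>. \<forall>x\<in>A. \<omega> x})"
    using finS by (intro measure_pmf.finite_measure_subadditive_finite) auto
  also have "\<dots> = (\<Sum>A\<in>?S. p ^ T)"
  proof (intro sum.cong refl)
    fix A assume "A \<in> ?S"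
    then show "measure_pmf.prob (percolation V p) {\<omega>. \<forall>x\<in>A. \<omega> x} = p ^ T"
      using assms by (subst prob_all_open) auto
  qed
  also have "\<dots> = real (card N choose T) * p ^ T"
    using n_subsets[OF finN, of T] by simp
  also have "\<dots> \<le> real (card N ^ T) * p ^ T"
    using binomial_le_pow[OF True] assms by (intro mult_right_mono) (auto simp flip: of_nat_power)
  finally show ?thesis by (simp add: power_mult_distrib)
qed

lemma bernoulli_and_bernoulli:
  assumes "0 \<le> p" "p \<le> 1" "0 \<le> r" "r \<le> 1"
  shows "map_pmf (\<lambda>(a, b). a \<and> b) (pair_pmf (bernoulli_pmf p) (bernoulli_pmf r)) = bernoulli_pmf (p * r)"
proof (rule pmf_eqI)
  have pr: "0 \<le> p * r" "p * r \<le> 1" using assms by (auto intro: mult_le_one)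
  have T: "pmf (map_pmf (\<lambda>(a, b). a \<and> b) (pair_pmf (bernoulli_pmf p) (bernoulli_pmf r))) True = p * r"
  proof -
    have "(\<lambda>(a, b). a \<and> b) -` {True} = {True} \<times> {True}" by auto
    then show ?thesis using assms
      by (simp add: pmf_map prob_pair_pmf_Times measure_pmf_single pmf_pair)
  qed
  fix b
  show "pmf (map_pmf (\<lambda>(a, b). a \<and> b) (pair_pmf (bernoulli_pmf p) (bernoulli_pmf r))) b
     = pmf (bernoulli_pmf (p * r)) b"
    using T pr by (cases b) (auto simp: pmf_False_conv_True)
qed

text \<open>
  If \<open>\<omega>\<close> has density \<open>q\<close> and \<open>\<eta>\<close> is an independent configuration of density \<open>p / q\<close>, then \<open>\<omega> \<and> \<eta>\<close> has
  density \<open>p\<close> and lies below \<open>\<omega>\<close>.  The inequality is strict because the outcome in which \<open>\<omega>\<close> is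
  all open and \<open>\<eta>\<close> all closed has positive probability.
\<close>

lemma prob_increasing_strict_mono:
  assumes fin: "finite V" and pq: "0 \<le> p" "p < q" "q \<le> 1"
    and incr: "\<And>\<omega> \<omega>'. (\<And>x. \<omega> x \<longrightarrow> \<omega>' x) \<Longrightarrow> \<omega> \<in> E \<Longrightarrow> \<omega>' \<in> E"
    and top: "(\<lambda>x. x \<in> V) \<in> E" and bot: "(\<lambda>x. False) \<notin> E"
  shows "measure_pmf.prob (percolation V p) E < measure_pmf.prob (percolation V q) E"
proof -
  define r where "r = p / q"
  have r: "0 \<le> r" "r < 1" "p = q * r" using pq by (auto simp: r_def)
  define M where "M = Pi_pmf V (False, False) (\<lambda>_. pair_pmf (bernoulli_pmf q) (bernoulli_pmf r))"
  have Mq: "percolation V q = map_pmf (\<lambda>h. fst \<circ> h) M"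
    unfolding M_def by (subst Pi_pmf_map[OF fin, symmetric]) (auto simp: map_fst_pair_pmf)
  have Mp: "percolation V p = map_pmf (\<lambda>h. (\<lambda>(a, b). a \<and> b) \<circ> h) M"
    unfolding M_def r(3) using pq r
    by (subst Pi_pmf_map[OF fin, symmetric]) (auto simp: bernoulli_and_bernoulli)
  define h0 where "h0 = (\<lambda>x. (x \<in> V, False))"
  let ?p = "{h. (\<lambda>(a, b). a \<and> b) \<circ> h \<in> E}" and ?q = "{h. fst \<circ> h \<in> E}"
  have "measure_pmf.prob M ?p + pmf M h0 = measure_pmf.prob M (?p \<union> {h0})"
  proof -
    have "(\<lambda>(a, b). a \<and> b) \<circ> h0 = (\<lambda>x. False)" by (auto simp: h0_def)
    then have "h0 \<notin> ?p" using bot by simp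
    then show ?thesis
      by (subst measure_pmf.finite_measure_Union) (auto simp: measure_pmf_single)
  qed
  also have "\<dots> \<le> measure_pmf.prob M ?q"
  proof (rule measure_pmf.finite_measure_mono)
    have "fst \<circ> h0 = (\<lambda>x. x \<in> V)" by (auto simp: h0_def)
    then have "h0 \<in> ?q" using top by simp
    moreover have "h \<in> ?q" if "h \<in> ?p" for h
      using that incr[of "(\<lambda>(a, b). a \<and> b) \<circ> h" "fst \<circ> h"] by (auto simp: case_prod_unfold)
    ultimately show "?p \<union> {h0} \<subseteq> ?q" by blast
  qed simp
  finally have "measure_pmf.prob M ?p + pmf M h0 \<le> measure_pmf.prob M ?q" .
  moreover have "pmf M h0 > 0"
  proof -
    have "pmf M h0 = (\<Prod>x\<in>V. pmf (pair_pmf (bernoulli_pmf q) (bernoulli_pmf r)) (h0 x))"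
      unfolding M_def by (rule pmf_Pi'[OF fin]) (auto simp: h0_def)
    also have "\<dots> > 0"
      using pq r by (intro prod_pos) (auto simp: h0_def pmf_pair)
    finally show ?thesis .
  qed
  ultimately show ?thesis
    unfolding Mp Mq by (simp add: vimage_def)
qed

text \<open>
  On the unit interval the probability is a polynomial in \<open>p\<close>: each of the finitely many
  configurations in \<open>E\<close> that are closed outside of \<open>V\<close> contributes a product of factors \<open>p\<close> and \<open>1 - p\<close>.
\<close>

lemma continuous_on_prob_percolation:
  assumes "finite V"
  shows "continuous_on {0..1} (\<lambda>p. measure_pmf.prob (percolation V p) E)"
proof -
  let ?S = "PiE_dflt V False (\<lambda>_. UNIV)"
  have fin: "finite ?S" using assms by auto
  have "measure_pmf.prob (percolation V p) E
       = (\<Sum>\<omega>\<in>E \<inter> ?S. \<Prod>x\<in>V. if \<omega> x then p else 1 - p)" if "p \<in> {0..1}" for p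
  proof -
    have "measure_pmf.prob (percolation V p) E = measure_pmf.prob (percolation V p) (E \<inter> ?S)"
      by (rule measure_prob_cong_0) (auto simp: PiE_dflt_def intro!: pmf_Pi_outside[OF assms])
    also have "\<dots> = (\<Sum>\<omega>\<in>E \<inter> ?S. pmf (percolation V p) \<omega>)"
      using fin by (intro measure_measure_pmf_finite) auto
    also have "\<dots> = (\<Sum>\<omega>\<in>E \<inter> ?S. \<Prod>x\<in>V. if \<omega> x then p else 1 - p)"
    proof (intro sum.cong refl)
      fix \<omega> assume "\<omega> \<in> E \<inter> ?S"
      then have "pmf (percolation V p) \<omega> = (\<Prod>x\<in>V. pmf (bernoulli_pmf p) (\<omega> x))"
        by (intro pmf_Pi'[OF assms]) (auto simp: PiE_dflt_def)
      also have "\<dots> = (\<Prod>x\<in>V. if \<omega> x then p else 1 - p)"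
        using that by (intro prod.cong) auto
      finally show "pmf (percolation V p) \<omega> = (\<Prod>x\<in>V. if \<omega> x then p else 1 - p)" .
    qed
    finally show ?thesis .
  qed
  moreover have "continuous_on {0..1} (\<lambda>p::real. \<Sum>\<omega>\<in>E \<inter> ?S. \<Prod>x\<in>V. if \<omega> x then p else 1 - p)"
  proof (intro continuous_on_sum continuous_on_prod)
    fix \<omega> :: "'a \<Rightarrow> bool" and x
    show "continuous_on {0..1} (\<lambda>p::real. if \<omega> x then p else 1 - p)"
      by (cases "\<omega> x") (auto intro!: continuous_intros)
  qed
  ultimately show ?thesis using continuous_on_cong[OF refl] by (metis (no_types, lifting))
qed

section \<open>Lines of the torus and the bootstrap dynamics\<close>

lemma finite_torus [simp]: "finite (torus n d)"
  by (auto simp: torus_def intro: finite_PiE)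

lemma torus_fun_upd [simp]: "v \<in> torus n d \<Longrightarrow> j < d \<Longrightarrow> t \<in> {1..n} \<Longrightarrow> v(j := t) \<in> torus n d"
  by (auto simp: torus_def PiE_iff extensional_def)

lemma torus_range: "v \<in> torus n d \<Longrightarrow> j < d \<Longrightarrow> v j \<in> {1..n}"
  unfolding torus_def by (drule PiE_mem) auto

definition line :: "nat \<Rightarrow> vertex \<Rightarrow> nat \<Rightarrow> vertex set" where
  "line n v j = (\<lambda>t. v(j := t)) ` {1..n}"

definition nbrs_along :: "nat \<Rightarrow> vertex \<Rightarrow> nat \<Rightarrow> vertex set" where
  "nbrs_along n v j = line n v j - {v}"

definition nbrs_off :: "nat \<Rightarrow> nat \<Rightarrow> vertex \<Rightarrow> nat \<Rightarrow> vertex set" where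
  "nbrs_off n d v j = (\<Union>i\<in>{..<d} - {j}. nbrs_along n v i)"

lemma finite_line [simp]: "finite (line n v j)"
  and finite_nbrs_along [simp]: "finite (nbrs_along n v j)"
  and finite_nbrs_off [simp]: "finite (nbrs_off n d v j)"
  by (auto simp: line_def nbrs_along_def nbrs_off_def)

lemma card_line: "card (line n v j) = n"
  unfolding line_def by (subst card_image) (auto simp: inj_on_def dest: fun_upd_eqD)

lemma line_subset_torus: "v \<in> torus n d \<Longrightarrow> j < d \<Longrightarrow> line n v j \<subseteq> torus n d"
  by (auto simp: line_def)

lemma line_eq: "w \<in> line n v j \<Longrightarrow> line n w j = line n v j"
  by (auto simp: line_def)

lemma neighbours_eq:
  assumes "v \<in> torus n d"
  shows "{w. w \<in> torus n d \<and> adjacent d v w} = (\<Union>j<d. nbrs_along n v j)"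
proof (intro set_eqI iffI)
  fix w assume "w \<in> {w. w \<in> torus n d \<and> adjacent d v w}"
  then have w: "w \<in> torus n d" "card {i \<in> {..<d}. v i \<noteq> w i} = 1"
    by (auto simp: adjacent_def)
  then obtain j where j: "{i \<in> {..<d}. v i \<noteq> w i} = {j}"
    by (auto simp: card_1_singleton_iff)
  then have "j < d" "v j \<noteq> w j" and eq: "\<And>i. i < d \<Longrightarrow> i \<noteq> j \<Longrightarrow> v i = w i" by auto
  have "w = v(j := w j)"
  proof
    fix i
    show "w i = (v(j := w j)) i"
      using eq[of i] assms w(1) by (cases "i < d") (auto simp: torus_def PiE_iff extensional_def)
  qed
  then have "w \<in> nbrs_along n v j"
    using \<open>v j \<noteq> w j\<close> torus_range[OF w(1) \<open>j < d\<close>] by (auto simp: nbrs_along_def line_def)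
  then show "w \<in> (\<Union>j<d. nbrs_along n v j)" using \<open>j < d\<close> by auto
next
  fix w assume "w \<in> (\<Union>j<d. nbrs_along n v j)"
  then obtain j t where w: "j < d" "t \<in> {1..n}" "w = v(j := t)" "w \<noteq> v"
    by (auto simp: nbrs_along_def line_def)
  then have "t \<noteq> v j" by auto
  with w have "{i \<in> {..<d}. v i \<noteq> w i} = {j}" by auto
  then show "w \<in> {w. w \<in> torus n d \<and> adjacent d v w}"
    using w assms by (auto simp: adjacent_def)
qed

lemma bp_step_iff:
  assumes "v \<in> torus n d"
  shows "bp_step n d \<theta> \<omega> v \<longleftrightarrow> \<omega> v \<or> \<theta> \<le> card {w \<in> (\<Union>j<d. nbrs_along n v j). \<omega> w}"
proof -
  have "(\<Sum>w | w \<in> torus n d \<and> adjacent d v w. of_bool (\<omega> w)) = card {w \<in> (\<Union>j<d. nbrs_along n v j). \<omega> w}"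
    unfolding neighbours_eq[OF assms] by (subst sum_of_bool_eq) (auto simp: Int_def)
  then show ?thesis using assms by (simp add: bp_step_def)
qed

lemma bp_config_0: "bp_config n d \<theta> \<omega> 0 = \<omega>"
  and bp_config_Suc: "bp_config n d \<theta> \<omega> (Suc k) = bp_step n d \<theta> (bp_config n d \<theta> \<omega> k)"
  by (simp_all add: bp_config_def)

lemma bp_limit_initial: "\<omega> v \<Longrightarrow> bp_limit n d \<theta> \<omega> v"
  unfolding bp_limit_iff by (rule exI[of _ 0]) (simp add: bp_config_0)

text \<open>
  Finitely many vertices that are eventually infected are all infected at a common time.
\<close>

lemma bp_limit_closed:
  assumes v: "v \<in> torus n d" and X: "X \<subseteq> (\<Union>j<d. nbrs_along n v j)" "\<theta> \<le> card X"
    and "\<And>w. w \<in> X \<Longrightarrow> bp_limit n d \<theta> \<omega> w"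
  shows "bp_limit n d \<theta> \<omega> v"
proof -
  have fin: "finite X" using X(1) by (rule finite_subset) auto
  have "\<forall>w\<in>X. \<exists>k. bp_config n d \<theta> \<omega> k w"
    using assms(4) unfolding bp_limit_iff by blast
  then obtain k where k: "\<And>w. w \<in> X \<Longrightarrow> bp_config n d \<theta> \<omega> (k w) w" by metis
  \<comment> \<open>The insertion of \<open>0\<close> keeps the maximum meaningful for empty \<open>X\<close>.\<close>
  define m where "m = Max (insert 0 (k ` X))"
  have km: "k w \<le> m" if "w \<in> X" for w
    using that fin by (auto simp: m_def)
  have "X \<subseteq> {w \<in> (\<Union>j<d. nbrs_along n v j). bp_config n d \<theta> \<omega> m w}"
    using X(1) by (auto intro: bp_config_mono[OF km k])
  then have "card X \<le> card {w \<in> (\<Union>j<d. nbrs_along n v j). bp_config n d \<theta> \<omega> m w}"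
    by (intro card_mono) auto
  then have "bp_config n d \<theta> \<omega> (Suc m) v"
    using X(2) by (simp add: bp_config_Suc bp_step_iff[OF v])
  then show ?thesis unfolding bp_limit_iff by blast
qed

lemma bp_step_mono:
  assumes "\<And>v. \<omega> v \<longrightarrow> \<omega>' v" "bp_step n d \<theta> \<omega> v"
  shows "bp_step n d \<theta> \<omega>' v"
proof (cases "v \<in> torus n d")
  case True
  have "card {w \<in> (\<Union>j<d. nbrs_along n v j). \<omega> w} \<le> card {w \<in> (\<Union>j<d. nbrs_along n v j). \<omega>' w}"
    using assms(1) by (intro card_mono) auto
  then show ?thesis using assms by (auto simp: bp_step_iff[OF True])
qed (use assms in \<open>auto simp: bp_step_def\<close>)

lemma bp_limit_mono:
  assumes "\<And>v. \<omega> v \<longrightarrow> \<omega>' v" "bp_limit n d \<theta> \<omega> v"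
  shows "bp_limit n d \<theta> \<omega>' v"
proof -
  have "bp_config n d \<theta> \<omega> k v \<longrightarrow> bp_config n d \<theta> \<omega>' k v" for k v
  proof (induction k arbitrary: v)
    case 0
    then show ?case using assms(1) by (simp add: bp_config_0)
  next
    case (Suc k)
    then show ?case using bp_step_mono by (simp add: bp_config_Suc) metis
  qed
  then show ?thesis using assms(2) unfolding bp_limit_iff by blast
qed

lemma bp_limit_empty:
  assumes "0 < \<theta>"
  shows "\<not> bp_limit n d \<theta> (\<lambda>_. False) v"
proof -
  have "bp_config n d \<theta> (\<lambda>_. False) k = (\<lambda>_. False)" for k
    by (induction k) (use assms in \<open>auto simp: bp_config_0 bp_config_Suc bp_step_def\<close>)
  then show ?thesis by (simp add: bp_limit_iff)
qed

section \<open>The critical probability\<close>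

definition plane_filled :: "nat \<Rightarrow> nat \<Rightarrow> nat \<Rightarrow> (vertex \<Rightarrow> bool) set" where
  "plane_filled n d \<theta> = {\<omega>. \<exists>F. two_dim_subgraph n d F \<and> (\<forall>v\<in>F. bp_limit n d \<theta> \<omega> v)}"

lemma prob_plane_filled_eq:
  "prob_plane_filled n d \<theta> p = measure_pmf.prob (percolation (torus n d) p) (plane_filled n d \<theta>)"
  by (simp add: prob_plane_filled_def initial_pmf_def plane_filled_def)

lemma two_dim_subgraph_nonempty: "two_dim_subgraph n d F \<Longrightarrow> F \<noteq> {}"
  by (auto simp: two_dim_subgraph_def)

lemma two_dim_subgraph_exists:
  assumes "2 \<le> d" "1 \<le> n"
  shows "\<exists>F. two_dim_subgraph n d F"
proof -
  have "(\<lambda>i\<in>{..<d}. 1) \<in> torus n d" using assms by (auto simp: torus_def)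
  moreover have "{0, 1} \<subseteq> {..<d}" "card {0, 1 :: nat} = 2" using assms by auto
  ultimately show ?thesis unfolding two_dim_subgraph_def by blast
qed

lemma prob_plane_filled_strict_mono:
  assumes "2 \<le> d" "1 \<le> n" "0 < \<theta>" "0 \<le> p" "p < q" "q \<le> 1"
  shows "prob_plane_filled n d \<theta> p < prob_plane_filled n d \<theta> q"
  unfolding prob_plane_filled_eq
proof (rule prob_increasing_strict_mono)
  show "(\<lambda>x. x \<in> torus n d) \<in> plane_filled n d \<theta>"
  proof -
    obtain F where F: "two_dim_subgraph n d F" using two_dim_subgraph_exists[of d n] assms by blast
    then have "F \<subseteq> torus n d" by (auto simp: two_dim_subgraph_def)
    then show ?thesis using F by (auto simp: plane_filled_def intro!: exI[of _ F] bp_limit_initial)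
  qed
  show "(\<lambda>x. False) \<notin> plane_filled n d \<theta>"
    using bp_limit_empty[OF assms(3)] two_dim_subgraph_nonempty unfolding plane_filled_def by blast
  show "\<omega>' \<in> plane_filled n d \<theta>" if "\<And>x. \<omega> x \<longrightarrow> \<omega>' x" "\<omega> \<in> plane_filled n d \<theta>" for \<omega> \<omega>'
    using that bp_limit_mono[of \<omega> \<omega>' n d \<theta>] unfolding plane_filled_def by blast
qed (use assms in auto)

text \<open>
  The intermediate value theorem gives a solution of \<open>prob_plane_filled n d \<theta> p = 1 / 2\<close> between \<open>a\<close>
  and \<open>b\<close>, and strict monotonicity makes it the only one.
\<close>

lemma p_crit2_between:
  assumes "2 \<le> d" "1 \<le> n" "0 < \<theta>" and a: "0 \<le> a" "a \<le> 1" "prob_plane_filled n d \<theta> a < 1 / 2"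
    and b: "0 \<le> b" "b \<le> 1" "1 / 2 \<le> prob_plane_filled n d \<theta> b"
  shows "a \<le> p_crit2 n d \<theta> \<and> p_crit2 n d \<theta> \<le> b"
proof -
  let ?f = "prob_plane_filled n d \<theta>"
  have mono: "?f p < ?f q" if "0 \<le> p" "p < q" "q \<le> 1" for p q
    using prob_plane_filled_strict_mono assms(1-3) that by blast
  have "a \<le> b"
  proof (rule ccontr)
    assume "\<not> a \<le> b"
    then show False using mono[of b a] a b by auto
  qed
  moreover have "continuous_on {a..b} ?f"
    unfolding prob_plane_filled_eq
    by (rule continuous_on_subset[OF continuous_on_prob_percolation]) (use a b in auto)
  ultimately obtain p where p: "a \<le> p" "p \<le> b" "?f p = 1 / 2"
    using IVT'[of ?f a "1 / 2" b] a b by auto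
  have "p_crit2 n d \<theta> = p"
    unfolding p_crit2_def
  proof (rule the_equality)
    show "0 \<le> p \<and> p \<le> 1 \<and> ?f p = 1 / 2" using p a b by auto
    show "q = p" if "0 \<le> q \<and> q \<le> 1 \<and> ?f q = 1 / 2" for q
      using mono[of p q] mono[of q p] that p a b by (cases p q rule: linorder_cases) auto
  qed
  then show ?thesis using p by simp
qed

section \<open>Hot lines: what a filled plane requires\<close>

text \<open>
  Hotness of \<open>w\<close> in direction \<open>j\<close> does not look at the line through \<open>w\<close> in direction \<open>j\<close>.  For
  distinct points of this line it is therefore decided by disjoint sets of vertices.
\<close>

definition hot :: "nat \<Rightarrow> nat \<Rightarrow> nat \<Rightarrow> (vertex \<Rightarrow> bool) \<Rightarrow> vertex \<Rightarrow> nat \<Rightarrow> bool" where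
  "hot n d T \<omega> w j \<longleftrightarrow> T \<le> card {u \<in> nbrs_off n d w j. \<omega> u}"

definition hot_lines :: "nat \<Rightarrow> nat \<Rightarrow> nat \<Rightarrow> nat \<Rightarrow> (vertex \<Rightarrow> bool) set" where
  "hot_lines n d T m =
     {\<omega>. \<exists>v\<in>torus n d. \<exists>j<d. m \<le> card {w \<in> line n v j. hot n d T \<omega> w j}}"

text \<open>
  The three reasons for an infection as long as no line has many hot points.  The last one covers
  the vertices whose open neighbours are spread over several directions; a threshold
  below \<open>\<theta>\<close> leaves room for help from fewer than \<open>m\<close> hot points on each of the \<open>d\<close> lines.
\<close>

definition explained :: "nat \<Rightarrow> nat \<Rightarrow> nat \<Rightarrow> nat \<Rightarrow> nat \<Rightarrow> (vertex \<Rightarrow> bool) \<Rightarrow> vertex \<Rightarrow> bool" where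
  "explained n d \<theta> T m \<omega> v \<longleftrightarrow> \<omega> v \<or> (\<exists>j<d. T < card {u \<in> line n v j. \<omega> u})
     \<or> \<theta> \<le> card {u \<in> (\<Union>j<d. nbrs_along n v j). \<omega> u} + d * m"

text \<open>
  The vertex \<open>w\<close> itself may be among the open vertices of its line in direction \<open>i\<close>, but is not one of
  its own neighbours; the strict inequality accounts for it.
\<close>

lemma rich_line_imp_hot:
  assumes "i < d" "i \<noteq> j" "T < card {u \<in> line n w i. \<omega> u}"
  shows "hot n d T \<omega> w j"
proof -
  have "{u \<in> line n w i. \<omega> u} \<subseteq> insert w {u \<in> nbrs_off n d w j. \<omega> u}"
    using assms by (auto simp: nbrs_off_def nbrs_along_def)
  then have "card {u \<in> line n w i. \<omega> u} \<le> card (insert w {u \<in> nbrs_off n d w j. \<omega> u})"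
    by (intro card_mono) auto
  also have "\<dots> \<le> Suc (card {u \<in> nbrs_off n d w j. \<omega> u})"
    by (intro card_insert_le_m1) auto
  finally show ?thesis using assms by (simp add: hot_def)
qed

text \<open>
  If \<open>w\<close> has \<open>\<theta> - d * m \<ge> 2 * T\<close> open neighbours and at most \<open>T\<close> of them are on the line in
  direction \<open>j\<close>, then at least \<open>T\<close> are off this line.
\<close>

lemma explained_imp_hot:
  assumes \<theta>: "2 * T + d * m \<le> \<theta>" and "explained n d \<theta> T m \<omega> w" "\<not> \<omega> w"
    and j: "j < d" and poor: "card {u \<in> line n w j. \<omega> u} \<le> T"
  shows "hot n d T \<omega> w j"
proof -
  consider i where "i < d" "T < card {u \<in> line n w i. \<omega> u}"
    | "\<theta> \<le> card {u \<in> (\<Union>j<d. nbrs_along n w j). \<omega> u} + d * m"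
    using assms(2,3) by (auto simp: explained_def)
  then show ?thesis
  proof cases
    case (1 i)
    then show ?thesis using poor by (intro rich_line_imp_hot[of i]) auto
  next
    case 2
    have "{u \<in> (\<Union>j<d. nbrs_along n w j). \<omega> u}
        \<subseteq> {u \<in> line n w j. \<omega> u} \<union> {u \<in> nbrs_off n d w j. \<omega> u}"
      by (auto simp: nbrs_off_def nbrs_along_def)
    then have "card {u \<in> (\<Union>j<d. nbrs_along n w j). \<omega> u}
        \<le> card ({u \<in> line n w j. \<omega> u} \<union> {u \<in> nbrs_off n d w j. \<omega> u})"
      by (intro card_mono) auto
    also have "\<dots> \<le> card {u \<in> line n w j. \<omega> u} + card {u \<in> nbrs_off n d w j. \<omega> u}"
      by (rule card_Un_le)
    finally show ?thesis using 2 \<theta> poor by (simp add: hot_def)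
  qed
qed

text \<open>
  Consider a vertex \<open>v\<close> that is about to become the first infected vertex without an explanation.
  None of its lines has more than \<open>T\<close> open vertices, so each of its infected neighbours is open
  or hot for the line that joins it to \<open>v\<close>.  There are fewer than \<open>m\<close> hot points on each of the \<open>d\<close>
  lines, hence at least \<open>\<theta> - d * m\<close> open neighbours, and this explains \<open>v\<close>.
\<close>

lemma infected_imp_explained:
  assumes \<theta>: "2 * T + d * m \<le> \<theta>" and cold: "\<omega> \<notin> hot_lines n d T m"
    and "v \<in> torus n d" "bp_config n d \<theta> \<omega> k v"
  shows "explained n d \<theta> T m \<omega> v"
  using assms(3,4)
proof (induction k arbitrary: v)
  case 0
  then show ?case by (simp add: bp_config_0 explained_def)
next
  case (Suc k)
  let ?N = "\<Union>j<d. nbrs_along n v j"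
  let ?I = "{w \<in> ?N. bp_config n d \<theta> \<omega> k w}"
  let ?H = "\<lambda>j. {w \<in> line n v j. hot n d T \<omega> w j}"
  show ?case
  proof (rule ccontr)
    assume neg: "\<not> explained n d \<theta> T m \<omega> v"
    then have "\<not> bp_config n d \<theta> \<omega> k v" using Suc by blast
    then have I: "\<theta> \<le> card ?I"
      using Suc.prems by (simp add: bp_config_Suc bp_step_iff)
    have "?I \<subseteq> {w \<in> ?N. \<omega> w} \<union> (\<Union>j<d. ?H j)"
    proof
      fix w assume w: "w \<in> ?I"
      then obtain j where j: "j < d" "w \<in> line n v j" by (auto simp: nbrs_along_def)
      have "w \<in> torus n d" using line_subset_torus[OF Suc.prems(1) j(1)] j(2) by blast
      then have "explained n d \<theta> T m \<omega> w" using Suc.IH w by blast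
      moreover have "card {u \<in> line n w j. \<omega> u} \<le> T"
        using neg j(1) by (auto simp: line_eq[OF j(2)] explained_def)
      ultimately have "\<omega> w \<or> hot n d T \<omega> w j"
        using explained_imp_hot[OF \<theta> _ _ j(1)] by blast
      then show "w \<in> {w \<in> ?N. \<omega> w} \<union> (\<Union>j<d. ?H j)" using w j by blast
    qed
    then have "card ?I \<le> card ({w \<in> ?N. \<omega> w} \<union> (\<Union>j<d. ?H j))"
      by (intro card_mono) auto
    also have "\<dots> \<le> card {w \<in> ?N. \<omega> w} + card (\<Union>j<d. ?H j)"
      by (rule card_Un_le)
    also have "card (\<Union>j<d. ?H j) \<le> (\<Sum>j<d. card (?H j))"
      by (rule card_UN_le) simp
    also have "\<dots> \<le> (\<Sum>j<d. m)"
      using cold Suc.prems(1) by (intro sum_mono) (auto simp: hot_lines_def not_le less_imp_le)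
    finally have "card ?I \<le> card {w \<in> ?N. \<omega> w} + d * m" by simp
    then show False using neg I by (auto simp: explained_def)
  qed
qed

text \<open>
  Otherwise all vertices of the plane are explained.  Let the plane be spanned by the directions \<open>a\<close>
  and \<open>b\<close>.  If one of its lines in direction \<open>b\<close> has at most \<open>T\<close> open vertices, then all its other vertices,
  of which there are at least \<open>n - T \<ge> m\<close>, are hot for it.  If all these lines have more than \<open>T\<close> open
  vertices, then every point of a line of the plane in direction \<open>a\<close> is hot for that line.
\<close>

lemma plane_filled_imp_hot_lines:
  assumes \<theta>: "2 * T + d * m \<le> \<theta>" and n: "T + m \<le> n" and filled: "\<omega> \<in> plane_filled n d \<theta>"
  shows "\<omega> \<in> hot_lines n d T m"
proof (rule ccontr)
  assume cold: "\<omega> \<notin> hot_lines n d T m"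
  obtain I u where I: "I \<subseteq> {..<d}" "card I = 2" and u: "u \<in> torus n d"
    and inf: "\<And>v. v \<in> torus n d \<Longrightarrow> (\<And>i. i \<in> {..<d} - I \<Longrightarrow> v i = u i) \<Longrightarrow> bp_limit n d \<theta> \<omega> v"
    using filled unfolding plane_filled_def two_dim_subgraph_def by blast
  obtain a b where ab: "I = {a, b}" "a \<noteq> b" using I(2) by (auto simp: card_2_iff)
  then have abd: "a < d" "b < d" using I(1) by auto
  have expl: "explained n d \<theta> T m \<omega> v"
    if "v \<in> torus n d" "\<And>i. i < d \<Longrightarrow> i \<noteq> a \<Longrightarrow> i \<noteq> b \<Longrightarrow> v i = u i" for v
    using inf[of v] that infected_imp_explained[OF \<theta> cold] unfolding bp_limit_iff ab by blast
  have few: "card {w \<in> line n v j. hot n d T \<omega> w j} < m" if "v \<in> torus n d" "j < d" for v j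
    using cold that by (auto simp: hot_lines_def not_le)
  show False
  proof (cases "\<exists>v \<in> line n u a. card {w \<in> line n v b. \<omega> w} \<le> T")
    case True
    then obtain v where v: "v \<in> line n u a" "card {w \<in> line n v b. \<omega> w} \<le> T" by blast
    have vt: "v \<in> torus n d" using line_subset_torus[OF u abd(1)] v(1) by blast
    have "line n v b \<subseteq> {w \<in> line n v b. \<omega> w} \<union> {w \<in> line n v b. hot n d T \<omega> w b}"
    proof
      fix w assume w: "w \<in> line n v b"
      have "w \<in> torus n d" using line_subset_torus[OF vt abd(2)] w by blast
      moreover have "w i = u i" if "i \<noteq> a" "i \<noteq> b" for i
        using that w v(1) by (auto simp: line_def)
      ultimately have "explained n d \<theta> T m \<omega> w" by (intro expl) auto
      moreover have "card {x \<in> line n w b. \<omega> x} \<le> T" using v(2) line_eq[OF w] by simp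
      ultimately show "w \<in> {w \<in> line n v b. \<omega> w} \<union> {w \<in> line n v b. hot n d T \<omega> w b}"
        using explained_imp_hot[OF \<theta> _ _ abd(2)] w by blast
    qed
    then have "card (line n v b) \<le> card ({w \<in> line n v b. \<omega> w} \<union> {w \<in> line n v b. hot n d T \<omega> w b})"
      by (intro card_mono) auto
    also have "\<dots> \<le> card {w \<in> line n v b. \<omega> w} + card {w \<in> line n v b. hot n d T \<omega> w b}"
      by (rule card_Un_le)
    finally show False using v(2) few[OF vt abd(2)] n by (simp add: card_line)
  next
    case False
    then have "hot n d T \<omega> w a" if "w \<in> line n u a" for w
      using that ab(2) abd(2) by (intro rich_line_imp_hot[of b]) (auto simp: not_le)
    then have "{w \<in> line n u a. hot n d T \<omega> w a} = line n u a" by blast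
    then show False using few[OF u abd(1)] n by (simp add: card_line)
  qed
qed

lemma card_nbrs_off_le: "card (nbrs_off n d w j) \<le> d * n"
proof -
  have "card (nbrs_off n d w j) \<le> (\<Sum>i\<in>{..<d} - {j}. card (nbrs_along n w i))"
    unfolding nbrs_off_def by (rule card_UN_le) simp
  also have "\<dots> \<le> (\<Sum>i\<in>{..<d} - {j}. n)"
  proof (rule sum_mono)
    fix i
    show "card (nbrs_along n w i) \<le> n"
      using card_mono[of "line n w i" "nbrs_along n w i"] by (simp add: nbrs_along_def card_line)
  qed
  also have "\<dots> \<le> (\<Sum>i<d. n)" by (rule sum_mono2) auto
  finally show ?thesis by simp
qed

lemma card_torus: "card (torus n d) = n ^ d"
  by (simp add: torus_def card_PiE)

lemma nbrs_off_subset_torus: "w \<in> torus n d \<Longrightarrow> nbrs_off n d w j \<subseteq> torus n d"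
  using line_subset_torus by (fastforce simp: nbrs_off_def nbrs_along_def)

lemma prob_hot_set_le:
  assumes v: "v \<in> torus n d" "j < d" and W: "W \<subseteq> line n v j" and p: "0 \<le> p" "p \<le> 1"
  shows "measure_pmf.prob (percolation (torus n d) p) {\<omega>. \<forall>w\<in>W. hot n d T \<omega> w j}
     \<le> ((real (d * n) * p) ^ T) ^ card W"
proof -
  let ?P = "percolation (torus n d) p"
  have finW: "finite W" using W finite_subset by fastforce
  have Wt: "w \<in> torus n d" if "w \<in> W" for w using line_subset_torus[OF v] W that by blast
  have "{\<omega>. \<forall>w\<in>W. hot n d T \<omega> w j} = (\<Inter>w\<in>W. {\<omega>. hot n d T \<omega> w j})" by auto
  also have "measure_pmf.prob ?P \<dots> = (\<Prod>w\<in>W. measure_pmf.prob ?P {\<omega>. hot n d T \<omega> w j})"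
  proof (rule prob_INT_independent)
    show "disjoint_family_on (\<lambda>w. nbrs_off n d w j) W"
      unfolding disjoint_family_on_def
    proof (intro ballI impI)
      fix w w' assume ww: "w \<in> W" "w' \<in> W" "w \<noteq> w'"
      obtain t t' where "w = v(j := t)" "w' = v(j := t')"
        using subsetD[OF W ww(1)] subsetD[OF W ww(2)] by (auto simp: line_def)
      then have "w j \<noteq> w' j" using ww(3) by auto
      moreover have "x j = w j" if "x \<in> nbrs_off n d w j" for x w
        using that by (auto simp: nbrs_off_def nbrs_along_def line_def)
      ultimately show "nbrs_off n d w j \<inter> nbrs_off n d w' j = {}" by (metis disjoint_iff)
    qed
    show "depends_on {\<omega>. hot n d T \<omega> w j} (nbrs_off n d w j)" for w
    proof -
      have "hot n d T \<omega> w j \<longleftrightarrow> hot n d T \<omega>' w j"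
        if "\<forall>u\<in>nbrs_off n d w j. \<omega> u = \<omega>' u" for \<omega> \<omega>'
      proof -
        have "{u \<in> nbrs_off n d w j. \<omega> u} = {u \<in> nbrs_off n d w j. \<omega>' u}" using that by auto
        then show ?thesis by (simp add: hot_def)
      qed
      then show ?thesis unfolding depends_on_def mem_Collect_eq by blast
    qed
  qed (use finW Wt nbrs_off_subset_torus in auto)
  also have "\<dots> \<le> (\<Prod>w\<in>W. (real (d * n) * p) ^ T)"
  proof (intro prod_mono conjI)
    fix w assume "w \<in> W"
    have "measure_pmf.prob ?P {\<omega>. hot n d T \<omega> w j} \<le> (real (card (nbrs_off n d w j)) * p) ^ T"
      unfolding hot_def using nbrs_off_subset_torus[OF Wt[OF \<open>w \<in> W\<close>]] p
      by (intro prob_many_open_le) auto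
    also have "\<dots> \<le> (real (d * n) * p) ^ T"
      using p card_nbrs_off_le[of n d w j] by (intro power_mono mult_right_mono) (auto simp flip: of_nat_mult)
    finally show "measure_pmf.prob ?P {\<omega>. hot n d T \<omega> w j} \<le> (real (d * n) * p) ^ T" .
  qed simp
  finally show ?thesis by simp
qed

text \<open>
  Union bound over the choice of a line, represented by one of its points and a direction, and
  of \<open>m\<close> of its points.
\<close>

lemma prob_hot_lines_le:
  assumes n: "m \<le> n" and p: "0 \<le> p" "p \<le> 1"
  shows "measure_pmf.prob (percolation (torus n d) p) (hot_lines n d T m)
     \<le> real d * real n ^ d * real n ^ m * ((real (d * n) * p) ^ T) ^ m"
proof -
  let ?P = "percolation (torus n d) p"
  let ?S = "\<lambda>v j. {W. W \<subseteq> line n v j \<and> card W = m}"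
  let ?J = "Sigma (torus n d \<times> {..<d}) (\<lambda>(v, j). ?S v j)"
  let ?E = "\<lambda>((v, j), W). {\<omega>. \<forall>w\<in>W. hot n d T \<omega> w j}"
  have finS: "finite (?S v j)" for v j by simp
  then have finJ: "finite ?J" by (intro finite_SigmaI) auto
  have "hot_lines n d T m \<subseteq> (\<Union>x\<in>?J. ?E x)"
  proof
    fix \<omega> assume "\<omega> \<in> hot_lines n d T m"
    then obtain v j where vj: "v \<in> torus n d" "j < d" "m \<le> card {w \<in> line n v j. hot n d T \<omega> w j}"
      by (auto simp: hot_lines_def)
    then obtain W where "W \<subseteq> {w \<in> line n v j. hot n d T \<omega> w j}" "card W = m"
      using obtain_subset_with_card_n by blast
    then have "((v, j), W) \<in> ?J" "\<omega> \<in> ?E ((v, j), W)" using vj by auto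
    then show "\<omega> \<in> (\<Union>x\<in>?J. ?E x)" by blast
  qed
  then have "measure_pmf.prob ?P (hot_lines n d T m) \<le> measure_pmf.prob ?P (\<Union>x\<in>?J. ?E x)"
    by (intro measure_pmf.finite_measure_mono) auto
  also have "\<dots> \<le> (\<Sum>x\<in>?J. measure_pmf.prob ?P (?E x))"
    using finJ by (intro measure_pmf.finite_measure_subadditive_finite) auto
  also have "\<dots> \<le> (\<Sum>x\<in>?J. ((real (d * n) * p) ^ T) ^ m)"
    using p by (intro sum_mono) (auto intro!: order_trans[OF prob_hot_set_le])
  also have "\<dots> = real (card ?J) * ((real (d * n) * p) ^ T) ^ m"
    by simp
  also have "\<dots> \<le> real (n ^ d * d * n ^ m) * ((real (d * n) * p) ^ T) ^ m"
  proof -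
    have "card ?J = (\<Sum>x\<in>torus n d \<times> {..<d}. card (case x of (v, j) \<Rightarrow> ?S v j))"
      by (rule card_SigmaI) (auto simp: finS)
    also have "\<dots> = (\<Sum>x\<in>torus n d \<times> {..<d}. n choose m)"
      using n_subsets[OF finite_line] by (intro sum.cong) (auto simp: card_line)
    also have "\<dots> = n ^ d * d * (n choose m)"
      by (simp add: card_cartesian_product card_torus)
    also have "\<dots> \<le> n ^ d * d * n ^ m"
      by (intro mult_left_mono binomial_le_pow n) auto
    finally show ?thesis using p by (intro mult_right_mono of_nat_mono) auto
  qed
  finally show ?thesis by (simp add: mult_ac)
qed

lemma prob_plane_filled_le:
  assumes "2 * T + d * m \<le> \<theta>" "T + m \<le> n" "0 \<le> p" "p \<le> 1"
  shows "prob_plane_filled n d \<theta> p \<le> real d * real n ^ d * real n ^ m * ((real (d * n) * p) ^ T) ^ m"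
proof -
  have "prob_plane_filled n d \<theta> p \<le> measure_pmf.prob (percolation (torus n d) p) (hot_lines n d T m)"
    unfolding prob_plane_filled_eq
    using plane_filled_imp_hot_lines[OF assms(1,2)] by (intro measure_pmf.finite_measure_mono) auto
  also have "\<dots> \<le> real d * real n ^ d * real n ^ m * ((real (d * n) * p) ^ T) ^ m"
    using assms by (intro prob_hot_lines_le) auto
  finally show ?thesis .
qed

section \<open>The subcritical regime\<close>

text \<open>
  For \<open>s = sqrt \<theta>\<close> and the choice of \<open>T\<close> and \<open>m \<ge> s\<close> made in \<open>hot_exponent_neg\<close>, the product
  \<open>(1 - d / s - (d + 1) / s\<^sup>2) * (1 + c / (2 * s))\<close> is a lower bound for \<open>T * \<alpha>\<close>.  The function below
  therefore bounds the exponent \<open>d + m * (1 - T * \<alpha>)\<close> wherever the function is negative.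
\<close>

lemma hot_exponent_tendsto:
  fixes c d :: real
  shows "((\<lambda>s. d + s * (1 - (1 - d / s - (d + 1) / s\<^sup>2) * (1 + c / (2 * s)))) \<longlongrightarrow> 2 * d - c / 2) at_top"
  by real_asymp

lemma powr_three_halves: "0 \<le> x \<Longrightarrow> x powr (3 / 2) = sqrt x ^ 3"
  by (cases "x = 0") (auto simp: powr_half_sqrt_powr powr_numeral sqrt_def real_root_power)

text \<open>
  A larger \<open>m\<close> asks for more hot points but lowers the threshold \<open>T\<close> that makes a point hot.
  With \<open>m\<close> about \<open>x * sqrt \<theta>\<close> the exponent becomes \<open>d + d * x\<^sup>2 - c * x / 2\<close> in the limit of large \<open>\<theta>\<close>,
  and \<open>x = 1\<close> minimises the value of \<open>c\<close> from which on it is negative.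
\<close>

lemma hot_exponent_neg:
  fixes c :: real
  assumes "0 < d" "4 * real d < c"
  shows "\<exists>\<theta>\<^sub>0. \<forall>\<theta>\<ge>\<theta>\<^sub>0. \<exists>T m. 2 * T + d * m \<le> \<theta> \<and>
     real d + real m * (1 - real T * (2 / real \<theta> + c / real \<theta> powr (3 / 2))) < 0"
proof -
  have "2 * real d - c / 2 < 0" using assms by simp
  then have "\<forall>\<^sub>F s in at_top. real d + s * (1 - (1 - real d / s - (real d + 1) / s\<^sup>2) * (1 + c / (2 * s))) < 0"
    by (rule order_tendstoD(2)[OF hot_exponent_tendsto])
  moreover have "\<forall>\<^sub>F s in at_top. real d * (s + 1) \<le> s\<^sup>2" by real_asymp
  moreover have "\<forall>\<^sub>F s in at_top. (s::real) > 0" by (rule eventually_gt_at_top)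
  ultimately have "\<forall>\<^sub>F s in at_top. 0 < s \<and> real d * (s + 1) \<le> s\<^sup>2 \<and>
      real d + s * (1 - (1 - real d / s - (real d + 1) / s\<^sup>2) * (1 + c / (2 * s))) < 0"
    by eventually_elim auto
  then have "\<forall>\<^sub>F \<theta> in sequentially. 0 < sqrt (real \<theta>) \<and> real d * (sqrt (real \<theta>) + 1) \<le> (sqrt (real \<theta>))\<^sup>2 \<and>
      real d + sqrt (real \<theta>) * (1 - (1 - real d / sqrt (real \<theta>) - (real d + 1) / (sqrt (real \<theta>))\<^sup>2) * (1 + c / (2 * sqrt (real \<theta>)))) < 0"
    by (rule eventually_compose_filterlim)
       (intro filterlim_compose[OF sqrt_at_top filterlim_real_sequentially])
  then obtain \<theta>\<^sub>0 where \<theta>\<^sub>0: "\<And>\<theta>. \<theta> \<ge> \<theta>\<^sub>0 \<Longrightarrow> 0 < sqrt (real \<theta>) \<and> real d * (sqrt (real \<theta>) + 1) \<le> (sqrt (real \<theta>))\<^sup>2 \<and>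
      real d + sqrt (real \<theta>) * (1 - (1 - real d / sqrt (real \<theta>) - (real d + 1) / (sqrt (real \<theta>))\<^sup>2) * (1 + c / (2 * sqrt (real \<theta>)))) < 0"
    unfolding eventually_sequentially by blast
  show ?thesis
  proof (rule exI[of _ \<theta>\<^sub>0], intro allI impI)
    fix \<theta> assume "\<theta>\<^sub>0 \<le> \<theta>"
    define s where "s = sqrt (real \<theta>)"
    define B where "B = (1 - real d / s - (real d + 1) / s\<^sup>2) * (1 + c / (2 * s))"
    have s: "0 < s" and ds: "real d * (s + 1) \<le> s\<^sup>2" and neg: "real d + s * (1 - B) < 0"
      using \<theta>\<^sub>0[OF \<open>\<theta>\<^sub>0 \<le> \<theta>\<close>] by (simp_all add: s_def B_def)
    have \<theta>: "real \<theta> = s\<^sup>2" by (simp add: s_def)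
    define m where "m = nat \<lceil>s\<rceil>"
    have m: "s \<le> real m" "real m \<le> s + 1" using s by (auto simp: m_def)
    define T where "T = (\<theta> - d * m) div 2"
    have "real (d * m) \<le> real d * (s + 1)" using m by (simp add: mult_left_mono)
    then have dm: "real (d * m) \<le> s * s" "real (d * m) \<le> real d * (s + 1)"
      using ds by (simp_all add: power2_eq_square)
    then have "d * m \<le> \<theta>" using \<theta> by (metis of_nat_le_iff power2_eq_square)
    then have le: "2 * T + d * m \<le> \<theta>" and ge: "\<theta> \<le> 2 * T + d * m + 1" by (auto simp: T_def)
    have "real \<theta> \<le> 2 * real T + real (d * m) + 1" using ge by linarith
    then have T: "(s\<^sup>2 - real d * (s + 1) - 1) / 2 \<le> real T" using dm \<theta> by simp
    have \<alpha>: "2 / real \<theta> + c / real \<theta> powr (3 / 2) = 2 / s\<^sup>2 * (1 + c / (2 * s))"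
      using s by (simp add: \<theta> powr_three_halves field_simps power2_eq_square power3_eq_cube)
    have c: "0 \<le> 1 + c / (2 * s)" using s assms by auto
    have "B = (s\<^sup>2 - real d * (s + 1) - 1) / 2 * (2 / s\<^sup>2 * (1 + c / (2 * s)))"
      using s by (simp add: B_def field_simps power2_eq_square)
    also have "\<dots> \<le> real T * (2 / s\<^sup>2 * (1 + c / (2 * s)))"
      using T c by (intro mult_right_mono) auto
    finally have B: "B \<le> real T * (2 / real \<theta> + c / real \<theta> powr (3 / 2))" unfolding \<alpha> .
    have "1 - B < 0"
      using neg s by (smt (verit) mult_nonneg_nonneg of_nat_0_le_iff)
    have "real m * (1 - real T * (2 / real \<theta> + c / real \<theta> powr (3 / 2))) \<le> real m * (1 - B)"
      using B by (intro mult_left_mono) auto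
    also have "\<dots> \<le> s * (1 - B)"
      using m \<open>1 - B < 0\<close> by (intro mult_right_mono_neg) auto
    finally have "real d + real m * (1 - real T * (2 / real \<theta> + c / real \<theta> powr (3 / 2))) < 0"
      using neg by simp
    then show "\<exists>T m. 2 * T + d * m \<le> \<theta> \<and>
     real d + real m * (1 - real T * (2 / real \<theta> + c / real \<theta> powr (3 / 2))) < 0"
      using le by blast
  qed
qed

text \<open>
  The factor that does not involve \<open>n\<close> in the bound of \<open>prob_plane_filled_le\<close> is constant, so a negative
  exponent of \<open>n\<close> makes the bound tend to zero.
\<close>

lemma subcritical:
  fixes c :: real
  assumes d: "0 < d" and c: "4 * real d < c"
  shows "\<exists>\<theta>\<^sub>0. \<forall>\<theta>\<ge>\<theta>\<^sub>0. \<forall>\<^sub>F n in sequentially.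
     prob_plane_filled n d \<theta> (real n powr (- 1 - 2 / real \<theta> - c / real \<theta> powr (3 / 2))) < 1 / 2"
proof -
  obtain \<theta>\<^sub>0 where \<theta>\<^sub>0: "\<And>\<theta>. \<theta>\<^sub>0 \<le> \<theta> \<Longrightarrow> \<exists>T m. 2 * T + d * m \<le> \<theta> \<and>
     real d + real m * (1 - real T * (2 / real \<theta> + c / real \<theta> powr (3 / 2))) < 0"
    using hot_exponent_neg[OF d c] by blast
  show ?thesis
  proof (intro exI[of _ \<theta>\<^sub>0] allI impI)
    fix \<theta> assume "\<theta>\<^sub>0 \<le> \<theta>"
    define \<alpha> where "\<alpha> = 2 / real \<theta> + c / real \<theta> powr (3 / 2)"
    obtain T m where Tm: "2 * T + d * m \<le> \<theta>" and neg: "real d + real m * (1 - real T * \<alpha>) < 0"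
      using \<theta>\<^sub>0[OF \<open>\<theta>\<^sub>0 \<le> \<theta>\<close>] by (auto simp: \<alpha>_def)
    have \<alpha>: "0 \<le> \<alpha>" using c by (simp add: \<alpha>_def)
    have eq: "- 1 - 2 / real \<theta> - c / real \<theta> powr (3 / 2) = - 1 - \<alpha>" by (simp add: \<alpha>_def)
    define C where "C = real d * real d ^ (T * m)"
    have "(\<lambda>n. C * real n powr (real d + real m * (1 - real T * \<alpha>))) \<longlonglongrightarrow> C * 0"
      by (intro tendsto_intros tendsto_neg_powr neg filterlim_real_sequentially)
    then have "\<forall>\<^sub>F n in sequentially. C * real n powr (real d + real m * (1 - real T * \<alpha>)) < 1 / 2"
      by (rule order_tendstoD(2)) simp
    moreover have "\<forall>\<^sub>F n in sequentially. max 1 (T + m) \<le> n" by (rule eventually_ge_at_top)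
    ultimately show "\<forall>\<^sub>F n in sequentially.
       prob_plane_filled n d \<theta> (real n powr (- 1 - 2 / real \<theta> - c / real \<theta> powr (3 / 2))) < 1 / 2"
      unfolding eq
    proof eventually_elim
      case (elim n)
      then have n: "0 < real n" "1 \<le> real n" "T + m \<le> n" by auto
      have "real n powr (- 1 - \<alpha>) \<le> 1" using n \<alpha> powr_mono[of "- 1 - \<alpha>" 0 "real n"] by simp
      then have "prob_plane_filled n d \<theta> (real n powr (- 1 - \<alpha>))
         \<le> real d * real n ^ d * real n ^ m * ((real (d * n) * real n powr (- 1 - \<alpha>)) ^ T) ^ m"
        by (intro prob_plane_filled_le Tm n) auto
      also have "real (d * n) * real n powr (- 1 - \<alpha>) = real d * real n powr (- \<alpha>)"
        using n by (simp add: powr_diff powr_minus field_simps)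
      also have "real d * real n ^ d * real n ^ m * ((real d * real n powr (- \<alpha>)) ^ T) ^ m
         = C * (real n ^ d * real n ^ m * (real n powr (- \<alpha>)) ^ (T * m))"
        by (simp add: C_def power_mult_distrib power_mult)
      also have "real n ^ d * real n ^ m * (real n powr (- \<alpha>)) ^ (T * m)
         = real n powr real d * real n powr real m * real n powr (real (T * m) * - \<alpha>)"
        using n by (simp add: powr_realpow powr_power mult.commute)
      also have "\<dots> = real n powr (real d + real m + real (T * m) * - \<alpha>)"
        by (simp only: powr_add)
      also have "real d + real m + real (T * m) * - \<alpha> = real d + real m * (1 - real T * \<alpha>)"
        by (simp add: algebra_simps)
      finally show ?case using elim by linarith
    qed
  qed
qed

section \<open>Seeded planes: a configuration that fills a plane\<close>

text \<open>
  Here \<open>g x y\<close> says that the vertex in row \<open>x\<close> and column \<open>y\<close> of a plane becomes infected.  The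
  intersection of row \<open>a i\<close> and column \<open>b j\<close> sees \<open>K - i\<close> and \<open>K - j\<close> infected vertices in \<open>X i\<close> and \<open>Y j\<close>,
  and \<open>j\<close> and \<open>i\<close> earlier intersections, in total at least \<open>2 * K\<close>.
\<close>

lemma grid_fills:
  fixes g :: "nat \<Rightarrow> nat \<Rightarrow> bool"
  assumes closed: "\<And>x y X Y. x \<in> S \<Longrightarrow> y \<in> S \<Longrightarrow> X \<subseteq> S - {y} \<Longrightarrow> Y \<subseteq> S - {x} \<Longrightarrow>
      (\<And>t. t \<in> X \<Longrightarrow> g x t) \<Longrightarrow> (\<And>t. t \<in> Y \<Longrightarrow> g t y) \<Longrightarrow> \<theta> \<le> card X + card Y \<Longrightarrow> g x y"
    and S: "finite S"
    and a: "inj_on a {..<\<theta>}" "a ` {..<\<theta>} \<subseteq> S" and b: "inj_on b {..<\<theta>}" "b ` {..<\<theta>} \<subseteq> S"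
    and X: "\<And>i. i < \<theta> \<Longrightarrow> X i \<subseteq> S - b ` {..<\<theta>} \<and> K - i \<le> card (X i) \<and> (\<forall>t\<in>X i. g (a i) t)"
    and Y: "\<And>i. i < \<theta> \<Longrightarrow> Y i \<subseteq> S - a ` {..<\<theta>} \<and> K - i \<le> card (Y i) \<and> (\<forall>t\<in>Y i. g t (b i))"
    and K: "\<theta> \<le> 2 * K" and xy: "x \<in> S" "y \<in> S"
  shows "g x y"
proof -
  have core: "g (a i) (b j)" if "i < \<theta>" "j < \<theta>" for i j
    using that
  proof (induction "i + j" arbitrary: i j rule: less_induct)
    case less
    have inja: "inj_on a {..<i}" and injb: "inj_on b {..<j}"
      using less.prems by (auto intro: inj_on_subset[OF a(1)] inj_on_subset[OF b(1)])
    have finX: "finite (X i)" "finite (Y j)"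
      using X[OF less.prems(1)] Y[OF less.prems(2)] S by (auto intro: finite_subset)
    have disj: "X i \<inter> b ` {..<j} = {}" "Y j \<inter> a ` {..<i} = {}"
      using X[OF less.prems(1)] Y[OF less.prems(2)] less.prems by fastforce+
    have "card (X i \<union> b ` {..<j}) = card (X i) + j" "card (Y j \<union> a ` {..<i}) = card (Y j) + i"
      using finX disj inja injb by (simp_all add: card_Un_disjoint card_image)
    then have card: "\<theta> \<le> card (X i \<union> b ` {..<j}) + card (Y j \<union> a ` {..<i})"
      using X[OF less.prems(1)] Y[OF less.prems(2)] K by linarith
    show ?case
    proof (rule closed[OF _ _ _ _ _ _ card])
      show "a i \<in> S" "b j \<in> S" using a b less.prems by auto
      have "b j \<notin> b ` {..<j}" "a i \<notin> a ` {..<i}"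
        using less.prems a(1) b(1) by (auto dest!: inj_onD)
      moreover have "b ` {..<j} \<subseteq> S" "a ` {..<i} \<subseteq> S" using less.prems a b by auto
      moreover have "b j \<notin> X i" "a i \<notin> Y j" using X[OF less.prems(1)] Y[OF less.prems(2)] less.prems by auto
      ultimately show "X i \<union> b ` {..<j} \<subseteq> S - {b j}" "Y j \<union> a ` {..<i} \<subseteq> S - {a i}"
        using X[OF less.prems(1)] Y[OF less.prems(2)] by blast+
      show "g (a i) t" if "t \<in> X i \<union> b ` {..<j}" for t
        using that X[OF less.prems(1)] less.hyps less.prems by auto
      show "g t (b j)" if "t \<in> Y j \<union> a ` {..<i}" for t
        using that Y[OF less.prems(2)] less.hyps less.prems by auto
    qed
  qed
  have row: "g (a i) y" if "i < \<theta>" "y \<in> S" for i y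
  proof (cases "y \<in> b ` {..<\<theta>}")
    case True
    then show ?thesis using core that by auto
  next
    case False
    show ?thesis
      by (rule closed[where X = "b ` {..<\<theta>}" and Y = "{}"])
         (use that a b False core in \<open>auto simp: card_image\<close>)
  qed
  show "g x y"
  proof (cases "x \<in> a ` {..<\<theta>}")
    case True
    then show ?thesis using row xy by auto
  next
    case False
    show ?thesis
      by (rule closed[where Y = "a ` {..<\<theta>}" and X = "{}"])
         (use xy a b False row in \<open>auto simp: card_image\<close>)
  qed
qed

text \<open>
  The coordinate values are cut into consecutive blocks of length \<open>N\<close>; this is entry \<open>r\<close> of block \<open>i\<close>.
\<close>

definition pos :: "nat \<Rightarrow> nat \<Rightarrow> nat \<Rightarrow> nat" where
  "pos N i r = i * N + r + 1"

lemma pos_eq_iff: "r < N \<Longrightarrow> r' < N \<Longrightarrow> pos N i r = pos N i' r' \<longleftrightarrow> i = i' \<and> r = r'"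
proof
  assume r: "r < N" "r' < N" and "pos N i r = pos N i' r'"
  then have eq: "r + i * N = r' + i' * N" by (simp add: pos_def)
  then have "(r + i * N) div N = (r' + i' * N) div N" by simp
  then have "i = i'" using r by simp
  then show "i = i' \<and> r = r'" using eq by simp
qed simp

lemma pos_range: "r < N \<Longrightarrow> i < k \<Longrightarrow> k * N \<le> n \<Longrightarrow> pos N i r \<in> {1..n}"
proof -
  assume "r < N" "i < k" "k * N \<le> n"
  then have "Suc i * N \<le> k * N" by (intro mult_right_mono) auto
  then show ?thesis using \<open>r < N\<close> \<open>k * N \<le> n\<close> by (simp add: pos_def)
qed

text \<open>
  A plane in the directions \<open>0\<close> and \<open>1\<close> is given by the coordinates from \<open>2\<close> on; the point \<open>z\<close>
  that fixes them is undefined at \<open>0\<close> and \<open>1\<close>.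
\<close>

definition in_plane :: "vertex \<Rightarrow> nat \<Rightarrow> nat \<Rightarrow> vertex" where
  "in_plane z x y = z(0 := x, 1 := y)"

definition plane_index :: "nat \<Rightarrow> nat \<Rightarrow> vertex set" where
  "plane_index n d = {2..<d} \<rightarrow>\<^sub>E {1..n}"

lemma finite_plane_index [simp]: "finite (plane_index n d)"
  by (auto simp: plane_index_def intro: finite_PiE)

lemma card_plane_index: "card (plane_index n d) = n ^ (d - 2)"
  by (simp add: plane_index_def card_PiE)

lemma in_plane_torus:
  "2 \<le> d \<Longrightarrow> z \<in> plane_index n d \<Longrightarrow> x \<in> {1..n} \<Longrightarrow> y \<in> {1..n} \<Longrightarrow> in_plane z x y \<in> torus n d"
  by (auto simp: in_plane_def plane_index_def torus_def PiE_iff extensional_def)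

lemma in_plane_eq_iff:
  assumes "z \<in> plane_index n d" "z' \<in> plane_index n d"
  shows "in_plane z x y = in_plane z' x' y' \<longleftrightarrow> z = z' \<and> x = x' \<and> y = y'"
proof
  assume eq: "in_plane z x y = in_plane z' x' y'"
  have "z i = z' i" for i
  proof (cases "i \<in> {0, 1}")
    case True
    then have "i \<notin> {2..<d}" by auto
    then show ?thesis using assms by (simp add: plane_index_def PiE_arb[of _ _ _ i])
  next
    case False
    then show ?thesis using fun_cong[OF eq, of i] by (simp add: in_plane_def)
  qed
  then show "z = z' \<and> x = x' \<and> y = y'"
    using fun_cong[OF eq, of 0] fun_cong[OF eq, of 1] by (auto simp: in_plane_def)
qed simp

lemma bp_limit_in_plane_closed:
  assumes d: "2 \<le> d" and z: "z \<in> plane_index n d" and xy: "x \<in> {1..n}" "y \<in> {1..n}"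
    and X: "X \<subseteq> {1..n} - {y}" and Y: "Y \<subseteq> {1..n} - {x}"
    and "\<And>t. t \<in> X \<Longrightarrow> bp_limit n d \<theta> \<omega> (in_plane z x t)"
    and "\<And>t. t \<in> Y \<Longrightarrow> bp_limit n d \<theta> \<omega> (in_plane z t y)"
    and \<theta>: "\<theta> \<le> card X + card Y"
  shows "bp_limit n d \<theta> \<omega> (in_plane z x y)"
proof (rule bp_limit_closed)
  let ?A = "in_plane z x ` X" and ?B = "(\<lambda>t. in_plane z t y) ` Y"
  let ?v = "in_plane z x y"
  show "?v \<in> torus n d" using in_plane_torus[OF d z xy] .
  have 1: "in_plane z x t = ?v(1 := t)" "in_plane z t y = ?v(0 := t)" for t
    by (auto simp: in_plane_def)
  have 2: "in_plane z x t \<noteq> ?v" if "t \<in> X" for t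
    using that X by (auto simp: in_plane_eq_iff[OF z z])
  have 3: "in_plane z t y \<noteq> ?v" if "t \<in> Y" for t
    using that Y by (auto simp: in_plane_eq_iff[OF z z])
  have "?A \<subseteq> nbrs_along n ?v 1"
  proof (rule image_subsetI)
    fix t assume "t \<in> X"
    then show "in_plane z x t \<in> nbrs_along n ?v 1"
      using 2[of t] X unfolding nbrs_along_def line_def 1(1)[of t] by auto
  qed
  moreover have "?B \<subseteq> nbrs_along n ?v 0"
  proof (rule image_subsetI)
    fix t assume "t \<in> Y"
    then show "in_plane z t y \<in> nbrs_along n ?v 0"
      using 3[of t] Y unfolding nbrs_along_def line_def 1(2)[of t] by auto
  qed
  moreover have "0 < d" "1 < d" using d by auto
  ultimately show "?A \<union> ?B \<subseteq> (\<Union>j<d. nbrs_along n ?v j)" by blast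
  have "finite X" "finite Y" using X Y by (auto intro: finite_subset)
  moreover have "?A \<inter> ?B = {}"
    using X Y by (auto simp: in_plane_eq_iff[OF z z])
  moreover have "card ?A = card X" "card ?B = card Y"
    by (auto intro!: card_image inj_onI simp: in_plane_eq_iff[OF z z])
  ultimately show "\<theta> \<le> card (?A \<union> ?B)" using \<theta> by (simp add: card_Un_disjoint)
  show "bp_limit n d \<theta> \<omega> w" if "w \<in> ?A \<union> ?B" for w
    using that assms by auto
qed

text \<open>
  For the direction \<open>D\<close>, the candidates for the \<open>i\<close>-th seed line are the \<open>N\<close> lines whose position is in
  block \<open>i < \<theta>\<close>, and \<open>r\<close> numbers them.  Along such a line only the blocks \<open>\<theta> + j\<close> are
  inspected.  Thus rows and columns inspect disjoint sets of vertices, none of them at an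
  intersection of a candidate row and a candidate column.
\<close>

definition site :: "nat \<Rightarrow> nat \<Rightarrow> vertex \<Rightarrow> bool \<Rightarrow> nat \<Rightarrow> nat \<Rightarrow> nat \<Rightarrow> nat \<Rightarrow> vertex" where
  "site \<theta> N z D i r j t =
     (if D then in_plane z (pos N i r) (pos N (\<theta> + j) t) else in_plane z (pos N (\<theta> + j) t) (pos N i r))"

lemma site_eq_iff:
  assumes "z \<in> plane_index n d" "z' \<in> plane_index n d" "r < N" "r' < N" "t < N" "t' < N" "i < \<theta>" "i' < \<theta>"
  shows "site \<theta> N z D i r j t = site \<theta> N z' D' i' r' j' t'
     \<longleftrightarrow> z = z' \<and> D = D' \<and> i = i' \<and> r = r' \<and> j = j' \<and> t = t'"
  using assms by (auto simp: site_def in_plane_eq_iff pos_eq_iff)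

lemma site_in_torus:
  assumes "2 \<le> d" "z \<in> plane_index n d" "r < N" "t < N" "i < \<theta>" "j < \<theta>" "2 * \<theta> * N \<le> n"
  shows "site \<theta> N z D i r j t \<in> torus n d"
proof -
  have "pos N i r \<in> {1..n}" "pos N (\<theta> + j) t \<in> {1..n}"
    by (rule pos_range[of _ _ _ "2 * \<theta>"]; use assms in simp)+
  then show ?thesis using assms by (auto simp: site_def intro!: in_plane_torus)
qed

text \<open>
  A line gets its \<open>K - i\<close> open vertices from distinct blocks, one in each.  In this way
  the event is an alternation of unions and intersections over disjoint sets of vertices, and its
  probability is estimated by independence alone.
\<close>

definition seeded :: "nat \<Rightarrow> nat \<Rightarrow> nat \<Rightarrow> vertex \<Rightarrow> (vertex \<Rightarrow> bool) set" where
  "seeded \<theta> K N z =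
     (\<Inter>(D, i)\<in>UNIV \<times> {..<\<theta>}. \<Union>r\<in>{..<N}. \<Inter>j\<in>{..<K - i}. \<Union>t\<in>{..<N}. {\<omega>. \<omega> (site \<theta> N z D i r j t)})"

lemma seeded_imp_plane_filled:
  assumes d: "2 \<le> d" and z: "z \<in> plane_index n d" and K: "K \<le> \<theta>" "\<theta> \<le> 2 * K"
    and N: "2 * \<theta> * N \<le> n" and n: "1 \<le> n" and seeded: "\<omega> \<in> seeded \<theta> K N z"
  shows "\<omega> \<in> plane_filled n d \<theta>"
proof -
  let ?g = "\<lambda>x y. bp_limit n d \<theta> \<omega> (in_plane z x y)"
  have ex: "\<exists>r<N. \<forall>j<K - i. \<exists>t<N. \<omega> (site \<theta> N z D i r j t)" if "i < \<theta>" for D i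
  proof -
    have "\<omega> \<in> (\<Union>r\<in>{..<N}. \<Inter>j\<in>{..<K - i}. \<Union>t\<in>{..<N}. {\<omega>. \<omega> (site \<theta> N z D i r j t)})"
      using INT_D[OF seeded[unfolded seeded_def], of "(D, i)"] that by simp
    then obtain r where "r < N" and r: "\<And>j. j < K - i \<Longrightarrow> \<exists>t\<in>{..<N}. \<omega> (site \<theta> N z D i r j t)"
      by auto
    then show ?thesis by (meson lessThan_iff)
  qed
  define r where "r D i = (SOME r. r < N \<and> (\<forall>j<K - i. \<exists>t<N. \<omega> (site \<theta> N z D i r j t)))" for D i
  have r': "r D i < N \<and> (\<forall>j<K - i. \<exists>t<N. \<omega> (site \<theta> N z D i (r D i) j t))" if "i < \<theta>" for D i
    unfolding r_def by (rule someI_ex[OF ex[OF that]])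
  then have r: "r D i < N" if "i < \<theta>" for D i using that by blast
  define t where "t D i j = (SOME t. t < N \<and> \<omega> (site \<theta> N z D i (r D i) j t))" for D i j
  have t': "t D i j < N \<and> \<omega> (site \<theta> N z D i (r D i) j (t D i j))" if "i < \<theta>" "j < K - i" for D i j
  proof -
    have "\<exists>t<N. \<omega> (site \<theta> N z D i (r D i) j t)" using r' that by blast
    then show ?thesis unfolding t_def by (rule someI_ex)
  qed
  then have t: "t D i j < N" and open_site: "\<omega> (site \<theta> N z D i (r D i) j (t D i j))"
    if "i < \<theta>" "j < K - i" for D i j
    using that by blast+
  define a where "a D i = pos N i (r D i)" for D i
  define X where "X D i = (\<lambda>j. pos N (\<theta> + j) (t D i j)) ` {..<K - i}" for D i
  have a_inj: "inj_on (a D) {..<\<theta>}" for D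
    by (rule inj_onI) (auto simp: a_def pos_eq_iff r)
  have a_range: "a D ` {..<\<theta>} \<subseteq> {1..n}" for D
  proof (rule image_subsetI)
    fix i assume "i \<in> {..<\<theta>}"
    then show "a D i \<in> {1..n}"
      unfolding a_def by (intro pos_range[of _ _ _ "2 * \<theta>"] r N) auto
  qed
  have X_range: "X D i \<subseteq> {1..n} - a D' ` {..<\<theta>}" if "i < \<theta>" for D D' i
  proof -
    have "X D i \<subseteq> {1..n}"
      unfolding X_def
    proof (rule image_subsetI)
      fix j assume "j \<in> {..<K - i}"
      then show "pos N (\<theta> + j) (t D i j) \<in> {1..n}"
        using that K by (intro pos_range[of _ _ _ "2 * \<theta>"] t N) auto
    qed
    moreover have "x \<notin> a D' ` {..<\<theta>}" if "x \<in> X D i" for x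
      using that \<open>i < \<theta>\<close> t r by (auto simp: X_def a_def pos_eq_iff)
    ultimately show ?thesis by blast
  qed
  have X_card: "card (X D i) = K - i" if "i < \<theta>" for D i
  proof -
    have "inj_on (\<lambda>j. pos N (\<theta> + j) (t D i j)) {..<K - i}"
      by (rule inj_onI) (use that t in \<open>auto simp: pos_eq_iff\<close>)
    then show ?thesis by (simp add: X_def card_image)
  qed
  \<comment> \<open>The rows are indexed by \<open>True\<close>, the columns by \<open>False\<close>.\<close>
  have XT: "?g (a True i) x" if "i < \<theta>" "x \<in> X True i" for i x
    using that open_site[of i _ True] by (auto simp: X_def a_def site_def intro!: bp_limit_initial)
  have XF: "?g x (a False i)" if "i < \<theta>" "x \<in> X False i" for i x
    using that open_site[of i _ False] by (auto simp: X_def a_def site_def intro!: bp_limit_initial)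
  have fill: "?g x y" if "x \<in> {1..n}" "y \<in> {1..n}" for x y
  proof (rule grid_fills[where S = "{1..n}" and \<theta> = \<theta> and K = K and a = "a True" and b = "a False"
        and X = "X True" and Y = "X False"])
    show "X True i \<subseteq> {1..n} - a False ` {..<\<theta>} \<and> K - i \<le> card (X True i) \<and> (\<forall>t\<in>X True i. ?g (a True i) t)"
      if "i < \<theta>" for i using X_range X_card XT that by simp
    show "X False i \<subseteq> {1..n} - a True ` {..<\<theta>} \<and> K - i \<le> card (X False i) \<and> (\<forall>t\<in>X False i. ?g t (a False i))"
      if "i < \<theta>" for i using X_range X_card XF that by simp
  qed (use a_inj a_range K that bp_limit_in_plane_closed[OF d z] in auto)
  let ?u = "in_plane z 1 1"
  let ?F = "{v \<in> torus n d. \<forall>i\<in>{..<d} - {0, 1}. v i = ?u i}"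
  have "?u \<in> torus n d" using in_plane_torus[OF d z] n by simp
  moreover have "{0, 1} \<subseteq> {..<d}" "card {0, 1 :: nat} = 2" using d by auto
  ultimately have "two_dim_subgraph n d ?F" unfolding two_dim_subgraph_def by blast
  moreover have "bp_limit n d \<theta> \<omega> v" if "v \<in> ?F" for v
  proof -
    have v: "v \<in> torus n d" using that by blast
    have "v i = in_plane z (v 0) (v 1) i" for i
    proof (cases "i < d")
      case True
      then show ?thesis using that by (auto simp: in_plane_def)
    next
      case False
      then show ?thesis using v z d
        by (auto simp: in_plane_def torus_def plane_index_def PiE_iff extensional_def)
    qed
    then have "v = in_plane z (v 0) (v 1)" by blast
    moreover have "v 0 \<in> {1..n}" "v 1 \<in> {1..n}" using torus_range[OF v] d by auto
    ultimately show ?thesis using fill by metis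
  qed
  ultimately show ?thesis unfolding plane_filled_def by blast
qed

lemma prob_INT_independent_ge:
  fixes P :: "'a \<Rightarrow> 'b pmf"
  assumes "finite V" "finite J" "disjoint_family_on B J"
    and "\<And>j. j \<in> J \<Longrightarrow> B j \<subseteq> V" and dep: "\<And>j. j \<in> J \<Longrightarrow> depends_on (E j) (B j)"
    and q: "\<And>j. j \<in> J \<Longrightarrow> 0 \<le> q j \<and> q j \<le> measure_pmf.prob (Pi_pmf V dflt P) (E j)"
  shows "(\<Prod>j\<in>J. q j) \<le> measure_pmf.prob (Pi_pmf V dflt P) (\<Inter>j\<in>J. E j)"
  using q by (subst prob_INT_independent[OF assms(1-5)]) (auto intro!: prod_mono)

text \<open>
  Each of the alternating unions and intersections contributes one application of
  \<open>prob_UN_independent_ge\<close> or \<open>prob_INT_independent_ge\<close>.  The sets \<open>B1, \<dots>, B4\<close> below are the vertices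
  inspected by the events at each level; they are disjoint because all indices
  can be read off from a site.
\<close>

lemma prob_seeded_ge:
  assumes d: "2 \<le> d" and K: "K \<le> \<theta>" and N: "2 * \<theta> * N \<le> n" and p: "0 \<le> p" "p \<le> 1"
  shows "min 1 (real (n ^ (d - 2)) * (\<Prod>(D :: bool, i)\<in>UNIV \<times> {..<\<theta>}.
            min 1 (real N * (min 1 (real N * p) / 2) ^ (K - i)) / 2)) / 2
     \<le> measure_pmf.prob (percolation (torus n d) p) (\<Union>z\<in>plane_index n d. seeded \<theta> K N z)"
proof -
  let ?V = "torus n d" and ?P = "percolation (torus n d) p" and ?Z = "plane_index n d"
  define E1 where "E1 z D i r j = (\<Union>t\<in>{..<N}. {\<omega>. \<omega> (site \<theta> N z D i r j t)})" for z D i r j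
  define B1 where "B1 z D i r j = (\<Union>t\<in>{..<N}. {site \<theta> N z D i r j t})" for z D i r j
  define E2 where "E2 z D i r = (\<Inter>j\<in>{..<K - i}. E1 z D i r j)" for z D i r
  define B2 where "B2 z D i r = (\<Union>j\<in>{..<K - i}. B1 z D i r j)" for z D i r
  define E3 where "E3 z D i = (\<Union>r\<in>{..<N}. E2 z D i r)" for z D i
  define B3 where "B3 z D i = (\<Union>r\<in>{..<N}. B2 z D i r)" for z D i
  let ?J = "UNIV \<times> {..<\<theta>} :: (bool \<times> nat) set"
  define B4 where "B4 z = (\<Union>x\<in>?J. B3 z (fst x) (snd x))" for z
  have seeded: "seeded \<theta> K N z = (\<Inter>x\<in>?J. E3 z (fst x) (snd x))" for z
    unfolding seeded_def E3_def E2_def E1_def by (simp add: case_prod_unfold)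
  have dep1: "depends_on (E1 z D i r j) (B1 z D i r j)" for z D i r j
    unfolding E1_def B1_def by (rule depends_on_UN) (simp add: depends_on_def)
  have dep2: "depends_on (E2 z D i r) (B2 z D i r)" for z D i r
    unfolding E2_def B2_def by (rule depends_on_INT) (rule dep1)
  have dep3: "depends_on (E3 z D i) (B3 z D i)" for z D i
    unfolding E3_def B3_def by (rule depends_on_UN) (rule dep2)
  have dep4: "depends_on (seeded \<theta> K N z) (B4 z)" for z
    unfolding seeded B4_def by (rule depends_on_INT) (rule dep3)
  have sub1: "B1 z D i r j \<subseteq> ?V" if "z \<in> ?Z" "i < \<theta>" "r < N" "j < \<theta>" for z D i r j
    using that site_in_torus[OF d _ _ _ _ _ N] by (auto simp: B1_def)
  have sub2: "B2 z D i r \<subseteq> ?V" if "z \<in> ?Z" "i < \<theta>" "r < N" for z D i r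
    using that K sub1[of z i r] unfolding B2_def by (intro UN_least) auto
  have sub3: "B3 z D i \<subseteq> ?V" if "z \<in> ?Z" "i < \<theta>" for z D i
    using that sub2 unfolding B3_def by (intro UN_least) auto
  have sub4: "B4 z \<subseteq> ?V" if "z \<in> ?Z" for z
    unfolding B4_def by (intro UN_least sub3 that) auto
  have inj: "site \<theta> N z D i r j t = site \<theta> N z' D' i' r' j' t'
     \<longleftrightarrow> z = z' \<and> D = D' \<and> i = i' \<and> r = r' \<and> j = j' \<and> t = t'"
    if "z \<in> ?Z" "z' \<in> ?Z" "r < N" "r' < N" "t < N" "t' < N" "i < \<theta>" "i' < \<theta>" for z z' D D' i i' r r' j j' t t'
    by (rule site_eq_iff[OF that])

  have ge1: "min 1 (real N * p) / 2 \<le> measure_pmf.prob ?P (E1 z D i r j)"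
    if "z \<in> ?Z" "i < \<theta>" "r < N" "j < \<theta>" for z D i r j
  proof -
    have "min 1 (real (card {..<N}) * p) / 2 \<le> measure_pmf.prob ?P (E1 z D i r j)"
      unfolding E1_def
    proof (rule prob_UN_independent_ge)
      show "disjoint_family_on (\<lambda>t. {site \<theta> N z D i r j t}) {..<N}"
        using that by (auto simp: disjoint_family_on_def inj)
      show "p \<le> measure_pmf.prob ?P {\<omega>. \<omega> (site \<theta> N z D i r j t)}" if "t \<in> {..<N}" for t
        using prob_all_open[of ?V "{site \<theta> N z D i r j t}" p] p that \<open>z \<in> ?Z\<close> \<open>i < \<theta>\<close> \<open>r < N\<close> \<open>j < \<theta>\<close>
          site_in_torus[OF d _ _ _ _ _ N] by simp
    qed (use that p site_in_torus[OF d _ _ _ _ _ N] in \<open>auto simp: depends_on_def\<close>)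
    then show ?thesis by simp
  qed
  have ge2: "(min 1 (real N * p) / 2) ^ (K - i) \<le> measure_pmf.prob ?P (E2 z D i r)"
    if "z \<in> ?Z" "i < \<theta>" "r < N" for z D i r
  proof -
    have "(\<Prod>j\<in>{..<K - i}. min 1 (real N * p) / 2) \<le> measure_pmf.prob ?P (E2 z D i r)"
      unfolding E2_def
    proof (rule prob_INT_independent_ge[OF _ _ _ _ dep1])
      show "disjoint_family_on (B1 z D i r) {..<K - i}"
        using that by (auto simp: disjoint_family_on_def B1_def inj)
      show "B1 z D i r j \<subseteq> ?V" if "j \<in> {..<K - i}" for j
        using that \<open>z \<in> ?Z\<close> \<open>i < \<theta>\<close> \<open>r < N\<close> K by (intro sub1) auto
      show "0 \<le> min 1 (real N * p) / 2 \<and> min 1 (real N * p) / 2 \<le> measure_pmf.prob ?P (E1 z D i r j)"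
        if "j \<in> {..<K - i}" for j
        using that \<open>z \<in> ?Z\<close> \<open>i < \<theta>\<close> \<open>r < N\<close> K p by (intro conjI ge1) auto
    qed auto
    then show ?thesis by simp
  qed
  have ge3: "min 1 (real N * (min 1 (real N * p) / 2) ^ (K - i)) / 2 \<le> measure_pmf.prob ?P (E3 z D i)"
    if "z \<in> ?Z" "i < \<theta>" for z D i
  proof -
    have "min 1 (real (card {..<N}) * (min 1 (real N * p) / 2) ^ (K - i)) / 2 \<le> measure_pmf.prob ?P (E3 z D i)"
      unfolding E3_def
    proof (rule prob_UN_independent_ge[OF _ _ _ _ dep2])
      show "disjoint_family_on (B2 z D i) {..<N}"
        using that by (auto simp: disjoint_family_on_def B2_def B1_def inj)
      show "B2 z D i r \<subseteq> ?V" if "r \<in> {..<N}" for r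
        using that \<open>z \<in> ?Z\<close> \<open>i < \<theta>\<close> by (intro sub2) auto
      show "(min 1 (real N * p) / 2) ^ (K - i) \<le> measure_pmf.prob ?P (E2 z D i r)"
        if "r \<in> {..<N}" for r
        using that \<open>z \<in> ?Z\<close> \<open>i < \<theta>\<close> by (intro ge2) auto
    qed (use p in auto)
    then show ?thesis by simp
  qed
  let ?q = "\<lambda>i. min 1 (real N * (min 1 (real N * p) / 2) ^ (K - i)) / 2"
  have ge4: "(\<Prod>x\<in>?J. ?q (snd x)) \<le> measure_pmf.prob ?P (seeded \<theta> K N z)"
    if "z \<in> ?Z" for z
    unfolding seeded
  proof (rule prob_INT_independent_ge[OF _ _ _ _ dep3])
    show "disjoint_family_on (\<lambda>x. B3 z (fst x) (snd x)) ?J"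
      using that by (auto simp: disjoint_family_on_def B3_def B2_def B1_def inj)
    show "B3 z (fst x) (snd x) \<subseteq> ?V" if "x \<in> ?J" for x
      using that \<open>z \<in> ?Z\<close> by (intro sub3) auto
    show "0 \<le> ?q (snd x) \<and> ?q (snd x) \<le> measure_pmf.prob ?P (E3 z (fst x) (snd x))" if "x \<in> ?J" for x
      using that \<open>z \<in> ?Z\<close> p by (intro conjI ge3) auto
  qed auto
  have "min 1 (real (card ?Z) * (\<Prod>x\<in>?J. ?q (snd x))) / 2
     \<le> measure_pmf.prob ?P (\<Union>z\<in>?Z. seeded \<theta> K N z)"
  proof (rule prob_UN_independent_ge[OF _ _ _ _ dep4])
    show "disjoint_family_on B4 ?Z"
      by (auto simp: disjoint_family_on_def B4_def B3_def B2_def B1_def inj)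
  qed (use sub4 ge4 p in \<open>auto intro!: prod_nonneg\<close>)
  then show ?thesis by (simp add: card_plane_index case_prod_unfold)
qed

lemma prob_plane_filled_ge:
  assumes "2 \<le> d" "K \<le> \<theta>" "\<theta> \<le> 2 * K" "2 * \<theta> * N \<le> n" "1 \<le> n" "0 \<le> p" "p \<le> 1"
  shows "min 1 (real (n ^ (d - 2)) * (\<Prod>(D :: bool, i)\<in>UNIV \<times> {..<\<theta>}.
            min 1 (real N * (min 1 (real N * p) / 2) ^ (K - i)) / 2)) / 2
     \<le> prob_plane_filled n d \<theta> p"
proof -
  have "measure_pmf.prob (percolation (torus n d) p) (\<Union>z\<in>plane_index n d. seeded \<theta> K N z)
     \<le> prob_plane_filled n d \<theta> p"
    unfolding prob_plane_filled_eq
    using seeded_imp_plane_filled[OF assms(1) _ assms(2-5)]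
    by (intro measure_pmf.finite_measure_mono) auto
  with prob_seeded_ge[OF assms(1,2,4,6,7)] show ?thesis by linarith
qed

section \<open>The supercritical regime\<close>

text \<open>
  The sum approximates the area \<open>A\<^sup>2 / (2 * q)\<close> of a triangle with height \<open>A\<close> and slope \<open>q\<close>.  The shift
  of \<open>A\<close> by \<open>q\<close> makes the bound inductive: \<open>A + A\<^sup>2 / (2 * q) \<le> (A + q)\<^sup>2 / (2 * q)\<close>.
\<close>

lemma sum_pos_part_le:
  fixes A q :: real
  assumes "0 < q"
  shows "(\<Sum>i<N. max 0 (A - q * real i)) \<le> (A + q)\<^sup>2 / (2 * q)"
proof (induction N arbitrary: A)
  case 0
  then show ?case using assms by simp
next
  case (Suc N)
  have "(\<Sum>i<Suc N. max 0 (A - q * real i)) = max 0 A + (\<Sum>i<N. max 0 ((A - q) - q * real i))"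
    by (subst sum.lessThan_Suc_shift) (simp add: algebra_simps)
  also have "\<dots> \<le> (A + q)\<^sup>2 / (2 * q)"
  proof (cases "A \<le> 0")
    case True
    have "(\<Sum>i<N. max 0 ((A - q) - q * real i)) = 0"
    proof (intro sum.neutral ballI)
      fix i
      have "0 \<le> q * real i" using assms by simp
      then show "max 0 ((A - q) - q * real i) = 0" using True assms by linarith
    qed
    then show ?thesis using True assms by simp
  next
    case False
    have "max 0 A + (\<Sum>i<N. max 0 ((A - q) - q * real i)) \<le> A + (A - q + q)\<^sup>2 / (2 * q)"
      using Suc.IH[of "A - q"] False by simp
    also have "\<dots> \<le> (A + q)\<^sup>2 / (2 * q)"
      using assms by (simp add: field_simps power2_eq_square)
    finally show ?thesis .
  qed
  finally show ?case .
qed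

text \<open>
  For \<open>s = sqrt \<theta>\<close> this function is the bound that \<open>sum_pos_part_le\<close> gives for the total exponent of all
  seed rows and columns of one plane.
\<close>

lemma seed_exponent_tendsto:
  fixes c :: real
  shows "((\<lambda>s. (c / 2 + 3 / s + c / (2 * s\<^sup>2))\<^sup>2 / 2) \<longlongrightarrow> c\<^sup>2 / 8) at_top"
proof -
  have "((\<lambda>s. c / 2 + 3 / s + c / (2 * s\<^sup>2)) \<longlongrightarrow> c / 2) at_top"
    by real_asymp
  then have "((\<lambda>s. (c / 2 + 3 / s + c / (2 * s\<^sup>2))\<^sup>2 / 2) \<longlongrightarrow> (c / 2)\<^sup>2 / 2) at_top"
    by (intro tendsto_intros) auto
  then show ?thesis by (simp add: power2_eq_square)
qed

text \<open>
  Among about \<open>n\<close> lines there is one with \<open>K - i\<close> open vertices with probability of order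
  \<open>n powr (- max 0 ((K - i) * \<alpha> - 1))\<close>.  To leading order, \<open>(K - i) * \<alpha> - 1\<close> falls linearly in \<open>i\<close>, from
  \<open>c / (2 * s)\<close> with slope \<open>2 / s\<^sup>2\<close>.
\<close>

lemma seed_exponent_bound:
  fixes c :: real
  assumes c: "0 \<le> c" and \<theta>: "0 < \<theta>" and "2 * K \<le> \<theta> + 1"
    and "s = sqrt (real \<theta>)" and "\<alpha> = 2 / real \<theta> + c / real \<theta> powr (3 / 2)"
  shows "real (K - i) * \<alpha> - 1 \<le> max 0 (c / (2 * s) + 1 / s\<^sup>2 + c / (2 * s ^ 3) - 2 / s\<^sup>2 * real i)"
proof -
  have s: "0 < s" "real \<theta> = s\<^sup>2" using assms by simp_all
  have \<alpha>: "\<alpha> = 2 / s\<^sup>2 + c / s ^ 3" using assms by (simp add: powr_three_halves)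
  have \<alpha>0: "0 \<le> \<alpha>" using s c by (simp add: \<alpha>)
  show ?thesis
  proof (cases "i \<le> K")
    case True
    have "2 * real K \<le> s\<^sup>2 + 1" using assms(3) s(2) by linarith
    then have "real (K - i) \<le> (s\<^sup>2 + 1) / 2 - real i" using True by (simp add: of_nat_diff)
    then have "real (K - i) * \<alpha> \<le> ((s\<^sup>2 + 1) / 2 - real i) * \<alpha>"
      using \<alpha>0 by (rule mult_right_mono)
    also have "\<dots> = 1 + (c / (2 * s) + 1 / s\<^sup>2 + c / (2 * s ^ 3) - 2 / s\<^sup>2 * real i) - real i * (c / s ^ 3)"
      using s by (simp add: \<alpha> field_simps power2_eq_square power3_eq_cube)
    finally have "real (K - i) * \<alpha> - 1
       \<le> (c / (2 * s) + 1 / s\<^sup>2 + c / (2 * s ^ 3) - 2 / s\<^sup>2 * real i) - real i * (c / s ^ 3)" by simp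
    moreover have "0 \<le> real i * (c / s ^ 3)" using s c by simp
    ultimately show ?thesis by linarith
  qed simp
qed

text \<open>
  The blocks have length \<open>N \<ge> n / (4 * \<theta>)\<close>; the power of \<open>8 * \<theta>\<close> collects this loss and the factors
  \<open>1 / 2\<close> for all the blocks along a line.
\<close>

lemma row_probability_ge:
  fixes \<alpha> e :: real
  assumes \<theta>: "0 < \<theta>" and n: "4 * \<theta> \<le> n" and \<alpha>: "0 \<le> \<alpha>" and k: "k \<le> \<theta>"
    and e: "real k * \<alpha> - 1 \<le> e" "0 \<le> e"
  defines "N \<equiv> n div (2 * \<theta>)" and "p \<equiv> real n powr (- 1 - \<alpha>)"
  shows "(1 / (8 * real \<theta>)) ^ (\<theta> + 1) * real n powr (- e)
     \<le> min 1 (real N * (min 1 (real N * p) / 2) ^ k)"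
proof -
  let ?b = "1 / (8 * real \<theta>)"
  have n1: "0 < real n" "1 \<le> real n" using \<theta> n by auto
  have b: "0 \<le> ?b" "?b \<le> 1" using \<theta> by auto
  have N_ge: "real n / (4 * real \<theta>) \<le> real N"
  proof -
    have "n < 2 * \<theta> * Suc N"
      unfolding N_def using dividend_less_times_div[of "2 * \<theta>" n] \<theta> by simp
    then have "real n < 2 * real \<theta> * (real N + 1)" by (metis of_nat_less_iff of_nat_mult of_nat_numeral of_nat_Suc add.commute)
    moreover have "4 * real \<theta> \<le> real n" using n by (metis of_nat_le_iff of_nat_mult of_nat_numeral)
    ultimately show ?thesis using \<theta> by (simp add: field_simps)
  qed
  have np: "real n * p = real n powr (- \<alpha>)"
    using n1 by (simp add: p_def powr_diff powr_minus field_simps)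
  have p0: "0 \<le> p" by (simp add: p_def)
  have "real N * p \<le> real n * p" using p0 by (intro mult_right_mono) (auto simp: N_def)
  also have "\<dots> \<le> 1" unfolding np using n1 \<alpha> powr_mono[of "- \<alpha>" 0 "real n"] by simp
  finally have Np1: "min 1 (real N * p) = real N * p" by simp
  have "real n / (4 * real \<theta>) * p \<le> real N * p" using N_ge p0 by (rule mult_right_mono)
  then have Np: "?b * real n powr (- \<alpha>) \<le> real N * p / 2"
    using np \<theta> by (simp add: field_simps)
  have "?b ^ (\<theta> + 1) * real n powr (- e) \<le> ?b ^ (k + 1) * real n powr (1 - real k * \<alpha>)"
    using b k e n1 by (intro mult_mono power_decreasing powr_mono) auto
  also have "real n powr (1 - real k * \<alpha>) = real n * (real n powr (- \<alpha>)) ^ k"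
  proof -
    have "(real n powr (- \<alpha>)) ^ k = real n powr (- \<alpha> * real k)" using n1 by (simp add: powr_power mult.commute)
    moreover have "real n powr (1 - real k * \<alpha>) = real n powr 1 * real n powr (- \<alpha> * real k)"
    proof -
      have "1 - real k * \<alpha> = 1 + - \<alpha> * real k" by simp
      then show ?thesis by (simp only: powr_add)
    qed
    ultimately show ?thesis using n1 by simp
  qed
  also have "?b ^ (k + 1) * (real n * (real n powr (- \<alpha>)) ^ k) = (?b * real n) * (?b * real n powr (- \<alpha>)) ^ k"
    unfolding power_mult_distrib power_add power_one_right by (simp only: mult_ac)
  also have "\<dots> \<le> real N * (real N * p / 2) ^ k"
  proof (intro mult_mono power_mono Np)
    show "?b * real n \<le> real N" using N_ge \<theta> by (simp add: field_simps)
  qed (use b p0 in auto)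
  finally have "?b ^ (\<theta> + 1) * real n powr (- e) \<le> real N * (min 1 (real N * p) / 2) ^ k"
    unfolding Np1 .
  moreover have "?b ^ (\<theta> + 1) * real n powr (- e) \<le> 1"
    using b n1 e powr_mono[of "- e" 0 "real n"] by (intro mult_le_one power_le_one) auto
  ultimately show ?thesis by simp
qed

text \<open>
  A single plane is seeded with probability at least a constant times \<open>n powr (- E)\<close>, where \<open>E\<close> tends
  to \<open>c\<^sup>2 / 8 < d - 2\<close> as \<open>\<theta>\<close> grows.  The \<open>n ^ (d - 2)\<close> planes then bring the expected number of
  seeded planes above one.
\<close>

lemma supercritical:
  fixes c :: real
  assumes d: "2 \<le> d" and c: "0 \<le> c" "c\<^sup>2 < 8 * (real d - 2)"
  shows "\<exists>\<theta>\<^sub>0. \<forall>\<theta>\<ge>\<theta>\<^sub>0. \<forall>\<^sub>F n in sequentially.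
     1 / 2 \<le> prob_plane_filled n d \<theta> (real n powr (- 1 - 2 / real \<theta> - c / real \<theta> powr (3 / 2)))"
proof -
  let ?E = "\<lambda>s::real. (c / 2 + 3 / s + c / (2 * s\<^sup>2))\<^sup>2 / 2"
  have "\<forall>\<^sub>F s in at_top. ?E s < real d - 2"
    using seed_exponent_tendsto by (rule order_tendstoD(2)) (use c in auto)
  then have "\<forall>\<^sub>F \<theta> in sequentially. ?E (sqrt (real \<theta>)) < real d - 2"
    by (rule eventually_compose_filterlim)
       (intro filterlim_compose[OF sqrt_at_top filterlim_real_sequentially])
  then obtain \<theta>\<^sub>0 where \<theta>\<^sub>0: "\<And>\<theta>. \<theta>\<^sub>0 \<le> \<theta> \<Longrightarrow> ?E (sqrt (real \<theta>)) < real d - 2"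
    unfolding eventually_sequentially by blast
  show ?thesis
  proof (rule exI[of _ "max 1 \<theta>\<^sub>0"], intro allI impI)
    fix \<theta> assume "max 1 \<theta>\<^sub>0 \<le> \<theta>"
    then have \<theta>: "0 < \<theta>" "\<theta>\<^sub>0 \<le> \<theta>" by auto
    define s where "s = sqrt (real \<theta>)"
    have s: "0 < s" using \<theta> by (simp add: s_def)
    define \<alpha> where "\<alpha> = 2 / real \<theta> + c / real \<theta> powr (3 / 2)"
    have \<alpha>: "0 \<le> \<alpha>" using c by (simp add: \<alpha>_def)
    have eq: "- 1 - 2 / real \<theta> - c / real \<theta> powr (3 / 2) = - 1 - \<alpha>" by (simp add: \<alpha>_def)
    define A where "A = c / (2 * s) + 1 / s\<^sup>2 + c / (2 * s ^ 3)"
    define e where "e i = max 0 (A - 2 / s\<^sup>2 * real i)" for i :: nat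
    \<comment> \<open>\<open>K\<close> is \<open>\<theta> / 2\<close> rounded up, so that \<open>2 * K\<close> reaches the threshold also for odd \<open>\<theta>\<close>.\<close>
    define K where "K = (\<theta> + 1) div 2"
    have K: "K \<le> \<theta>" "\<theta> \<le> 2 * K" "2 * K \<le> \<theta> + 1" using \<theta> by (auto simp: K_def)
    have e: "real (K - i) * \<alpha> - 1 \<le> e i" "0 \<le> e i" for i
      using seed_exponent_bound[OF c(1) \<theta>(1) K(3) s_def \<alpha>_def] by (simp_all add: e_def A_def)
    define E where "E = ?E s"
    have "2 * (\<Sum>i<\<theta>. e i) \<le> 2 * ((A + 2 / s\<^sup>2)\<^sup>2 / (2 * (2 / s\<^sup>2)))"
      unfolding e_def using s by (intro mult_left_mono sum_pos_part_le) auto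
    also have "\<dots> = ?E s"
      using s by (simp add: A_def field_simps power2_eq_square power3_eq_cube)
    finally have sum_e: "2 * (\<Sum>i<\<theta>. e i) \<le> E"
      unfolding E_def .
    define C where "C = (1 / (8 * real \<theta>)) ^ (\<theta> + 1)"
    have C: "0 < C" using \<theta> by (simp add: C_def)
    have E: "0 < real d - 2 - E"
      using \<theta>\<^sub>0[OF \<theta>(2)] unfolding E_def s_def by linarith
    have "LIM n sequentially. real n powr (real d - 2 - E) :> at_top"
      using E by real_asymp
    then have "filterlim (\<lambda>n. (C / 2) ^ (2 * \<theta>) * real n powr (real d - 2 - E)) at_top sequentially"
      using C by (intro filterlim_tendsto_pos_mult_at_top[OF tendsto_const]) auto
    then have "\<forall>\<^sub>F n in sequentially. 1 \<le> (C / 2) ^ (2 * \<theta>) * real n powr (real d - 2 - E)"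
      by (simp add: filterlim_at_top)
    moreover have "\<forall>\<^sub>F n in sequentially. 4 * \<theta> \<le> n" by (rule eventually_ge_at_top)
    ultimately show "\<forall>\<^sub>F n in sequentially.
       1 / 2 \<le> prob_plane_filled n d \<theta> (real n powr (- 1 - 2 / real \<theta> - c / real \<theta> powr (3 / 2)))"
      unfolding eq
    proof eventually_elim
      case (elim n)
      then have n: "0 < real n" "1 \<le> real n" "1 \<le> n" using \<theta> by auto
      define N where "N = n div (2 * \<theta>)"
      define p where "p = real n powr (- 1 - \<alpha>)"
      have p: "0 \<le> p" "p \<le> 1" using n \<alpha> powr_mono[of "- 1 - \<alpha>" 0 "real n"] by (simp_all add: p_def)
      let ?q = "\<lambda>i. min 1 (real N * (min 1 (real N * p) / 2) ^ (K - i)) / 2"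
      \<comment> \<open>For \<open>i \<ge> A * s\<^sup>2 / 2\<close>, which is close to \<open>c * s / 4\<close>, the exponent \<open>e i\<close> vanishes: such lines
        cost a constant factor only.\<close>
      have q: "C * real n powr (- e i) / 2 \<le> ?q i" for i
        unfolding C_def N_def p_def
        by (intro divide_right_mono row_probability_ge \<theta> elim \<alpha> e) (use K in auto)
      have "real n ^ (d - 2) = real n powr (real d - 2)"
        using n d by (simp add: of_nat_diff flip: powr_realpow)
      then have "real n ^ (d - 2) * real n powr (- E) = real n powr (real d - 2 - E)"
        by (simp add: powr_add[symmetric])
      then have "1 \<le> (C / 2) ^ (2 * \<theta>) * (real n ^ (d - 2) * real n powr (- E))"
        using elim by simp
      also have "\<dots> \<le> (C / 2) ^ (2 * \<theta>) * (real n ^ (d - 2) * real n powr (- 2 * (\<Sum>i<\<theta>. e i)))"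
        using n sum_e C by (intro mult_left_mono powr_mono) auto
      also have "\<dots> = real (n ^ (d - 2)) * (\<Prod>(D :: bool, i)\<in>UNIV \<times> {..<\<theta>}. C * real n powr (- e i) / 2)"
      proof -
        have "(\<Prod>i<\<theta>. C * real n powr (- e i) / 2) = (\<Prod>i<\<theta>. (C / 2) * real n powr (- e i))"
          by simp
        also have "\<dots> = (C / 2) ^ \<theta> * (\<Prod>i<\<theta>. real n powr (- e i))"
          by (simp only: prod.distrib prod_constant card_lessThan)
        also have "(\<Prod>i<\<theta>. real n powr (- e i)) = real n powr (- (\<Sum>i<\<theta>. e i))"
          using n by (simp only: powr_sum[symmetric] sum_negf finite_lessThan)
        finally have one: "(\<Prod>i<\<theta>. C * real n powr (- e i) / 2)
          = (C / 2) ^ \<theta> * real n powr (- (\<Sum>i<\<theta>. e i))" .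
        have "(\<Prod>(D :: bool, i)\<in>UNIV \<times> {..<\<theta>}. C * real n powr (- e i) / 2)
          = (\<Prod>D\<in>(UNIV :: bool set). \<Prod>i<\<theta>. C * real n powr (- e i) / 2)"
          by (simp only: prod.cartesian_product)
        also have "\<dots> = ((C / 2) ^ \<theta> * real n powr (- (\<Sum>i<\<theta>. e i)))\<^sup>2"
          unfolding one by (simp only: prod_constant card_UNIV_bool)
        also have "\<dots> = (C / 2) ^ (2 * \<theta>) * (real n powr (- (\<Sum>i<\<theta>. e i)))\<^sup>2"
          by (simp only: power_mult_distrib power_even_eq)
        also have "(real n powr (- (\<Sum>i<\<theta>. e i)))\<^sup>2 = real n powr (- 2 * (\<Sum>i<\<theta>. e i))"
          using n by (simp add: powr_power)
        finally show ?thesis by (simp only: of_nat_power mult.left_commute)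
      qed
      also have "\<dots> \<le> real (n ^ (d - 2)) * (\<Prod>(D :: bool, i)\<in>UNIV \<times> {..<\<theta>}. ?q i)"
        using q C by (intro mult_left_mono prod_mono) auto
      finally have "1 / 2 \<le> min 1 (real (n ^ (d - 2)) * (\<Prod>(D :: bool, i)\<in>UNIV \<times> {..<\<theta>}. ?q i)) / 2"
        by simp
      also have "\<dots> \<le> prob_plane_filled n d \<theta> p"
        by (rule prob_plane_filled_ge[OF d K(1,2) _ n(3) p]) (simp add: N_def)
      finally show ?case by (simp add: p_def)
    qed
  qed
qed

section \<open>The bounds on the critical probability\<close>

theorem theorem2p4:
  fixes d :: nat
  assumes "d \<ge> 3"
  shows "\<exists>\<theta>\<^sub>0. \<forall>\<theta>::nat. \<theta> \<ge> \<theta>\<^sub>0 \<longrightarrow>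
    (\<exists>n\<^sub>0. \<forall>n::nat. n \<ge> n\<^sub>0 \<longrightarrow>
       real n powr (- 1 - 2 / real \<theta> - (4 * (real d)\<^sup>2 + 3) / real \<theta> powr (3 / 2))
         \<le> p_crit2 n d \<theta> \<and>
       p_crit2 n d \<theta>
         \<le> real n powr (- 1 - 2 / real \<theta> - sqrt (8 * (real d - 2.1)) / real \<theta> powr (3 / 2)))"
proof -
  define c1 where "c1 = 4 * (real d)\<^sup>2 + 3"
  define c2 where "c2 = sqrt (8 * (real d - 2.1))"
  have "real d * 1 \<le> real d * real d" using assms by (intro mult_left_mono) auto
  then have c1: "4 * real d < c1" by (simp add: c1_def power2_eq_square)
  have c2: "0 \<le> c2" "c2\<^sup>2 < 8 * (real d - 2)" using assms by (auto simp: c2_def)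
  obtain \<theta>\<^sub>1 where low: "\<And>\<theta>. \<theta>\<^sub>1 \<le> \<theta> \<Longrightarrow> \<forall>\<^sub>F n in sequentially.
     prob_plane_filled n d \<theta> (real n powr (- 1 - 2 / real \<theta> - c1 / real \<theta> powr (3 / 2))) < 1 / 2"
    using subcritical[OF _ c1] assms by auto
  obtain \<theta>\<^sub>2 where high: "\<And>\<theta>. \<theta>\<^sub>2 \<le> \<theta> \<Longrightarrow> \<forall>\<^sub>F n in sequentially.
     1 / 2 \<le> prob_plane_filled n d \<theta> (real n powr (- 1 - 2 / real \<theta> - c2 / real \<theta> powr (3 / 2)))"
    using supercritical[OF _ c2] assms by auto
  show ?thesis
    unfolding c1_def[symmetric] c2_def[symmetric]
  proof (rule exI[of _ "max 1 (max \<theta>\<^sub>1 \<theta>\<^sub>2)"], intro allI impI)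
    fix \<theta> :: nat
    assume "max 1 (max \<theta>\<^sub>1 \<theta>\<^sub>2) \<le> \<theta>"
    then have \<theta>: "0 < \<theta>" "\<theta>\<^sub>1 \<le> \<theta>" "\<theta>\<^sub>2 \<le> \<theta>" by auto
    have unit: "0 \<le> real n powr (- 1 - 2 / real \<theta> - c / real \<theta> powr (3 / 2))"
      "real n powr (- 1 - 2 / real \<theta> - c / real \<theta> powr (3 / 2)) \<le> 1" if "1 \<le> n" "0 \<le> c" for n :: nat and c
    proof -
      have "- 1 - 2 / real \<theta> - c / real \<theta> powr (3 / 2) \<le> 0"
        using that by (smt (verit) divide_nonneg_nonneg of_nat_0_le_iff powr_ge_zero)
      then show "real n powr (- 1 - 2 / real \<theta> - c / real \<theta> powr (3 / 2)) \<le> 1"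
        using that powr_mono[of _ 0 "real n"] by fastforce
    qed simp
    have "\<forall>\<^sub>F n in sequentially. 1 \<le> n" by (rule eventually_ge_at_top)
    with low[OF \<theta>(2)] high[OF \<theta>(3)] have "\<forall>\<^sub>F n in sequentially.
        real n powr (- 1 - 2 / real \<theta> - c1 / real \<theta> powr (3 / 2)) \<le> p_crit2 n d \<theta> \<and>
        p_crit2 n d \<theta> \<le> real n powr (- 1 - 2 / real \<theta> - c2 / real \<theta> powr (3 / 2))"
    proof eventually_elim
      case (elim n)
      show ?case
        by (rule p_crit2_between) (use elim assms \<theta> c1 c2 unit in auto)
    qed
    then show "\<exists>n\<^sub>0. \<forall>n\<ge>n\<^sub>0.
        real n powr (- 1 - 2 / real \<theta> - c1 / real \<theta> powr (3 / 2)) \<le> p_crit2 n d \<theta> \<and>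
        p_crit2 n d \<theta> \<le> real n powr (- 1 - 2 / real \<theta> - c2 / real \<theta> powr (3 / 2))"
      unfolding eventually_sequentially .
  qed
qed

end
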